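(* Let $p$ be an odd prime. Then there does not exist a $(4p,p,4p,4)$ relative difference set in $G=\mathbb{Z}_4\times\mathbb{Z}_p^2$ (relative to any subgroup of order $p$).
   Context: Let $G$ be a finite group of order $mn$ and $N$ a subgroup of order $n$. A $k$-subset $R$ of $G$ is an $(m,n,k,\lambda)$ relative difference set in $G$ relative to $N$ if every element $g\in G\setminus N$ has exactly $\lambda$ representations $g=r_1r_2^{-1}$ with $r_1,r_2\in R$, and no non-identity element of $N$ has such a representation. *)

theory Defs
  imports "HOL-Algebra.Elementary_Groups" "HOL-Computational_Algebra.Primes"
begin

definition relative_difference_set ::
  "('a, 'b) monoid_scheme \<Rightarrow> 'a set \<Rightarrow> nat \<Rightarrow> nat \<Rightarrow> nat \<Rightarrow> nat \<Rightarrow> 'a set \<Rightarrow> bool" where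
  "relative_difference_set G N m n k l R \<longleftrightarrow>
     group G \<and> finite (carrier G) \<and> order G = m * n \<and>
     subgroup N G \<and> card N = n \<and>
     R \<subseteq> carrier G \<and> card R = k \<and>
     (\<forall>g \<in> carrier G - N.
        card {(r1, r2). r1 \<in> R \<and> r2 \<in> R \<and> g = r1 \<otimes>\<^bsub>G\<^esub> inv\<^bsub>G\<^esub> r2} = l) \<and>
     (\<forall>g \<in> N - {\<one>\<^bsub>G\<^esub>}.
        \<not> (\<exists>r1 \<in> R. \<exists>r2 \<in> R. g = r1 \<otimes>\<^bsub>G\<^esub> inv\<^bsub>G\<^esub> r2))"

end

theory Submission
  imports Defs "HOL-Number_Theory.Residues" "HOL-Computational_Algebra.Polynomial"
begin

text \<open>
  The set \<open>R\<close> meets every coset of \<open>N\<close> once, so it is the graph of a function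
  \<open>f : \<int>\<^sub>4 \<times> \<int>\<^sub>p \<rightarrow> \<int>\<^sub>p\<close>, and a character that is nontrivial on \<open>N\<close> gives a sum
  \<open>\<Sum>x<4. \<i> ^ (j * x) * E x\<close> of absolute value squared \<open>4 * p\<close>, where
  \<open>E x = (\<Sum>t. \<zeta> ^ (f x t + c * t))\<close>. Put \<open>S = E 0 + E 2\<close> and \<open>T = E 1 + E 3\<close>.
  Then \<open>|S|\<^sup>2 + |T|\<^sup>2 = 4 * p\<close> and \<open>S * cnj T\<close> is purely imaginary. Comparing the characters with
  \<open>j\<close> even and \<open>j\<close> odd modulo 2 shows that 2 divides \<open>|S|\<^sup>2\<close>, and the total ramification of \<open>p\<close>
  shows that \<open>p\<close> divides \<open>|S|\<^sup>2\<close> and \<open>S * cnj T\<close>. So \<open>|S|\<^sup>2 / (2 * p) - 1\<close> is an algebraic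
  integer all of whose conjugates lie in \<open>[-1, 1]\<close>, hence each is \<open>0\<close>, \<open>1\<close> or \<open>-1\<close>. The value
  \<open>0\<close> would give \<open>(S * cnj T / p)\<^sup>2 = -4\<close>, but a purely imaginary element of \<open>\<int>[\<zeta>]\<close> is
  divisible by \<open>1 - \<zeta>\<close>, and a trace argument excludes this. Thus for every \<open>c\<close> one of \<open>S\<close>, \<open>T\<close>
  vanishes. By Parseval the number of \<open>c\<close> with \<open>T = 0\<close> is, up to a factor 4, the sum of
  \<open>|\<zeta> ^ f 0 t + \<zeta> ^ f 2 t|\<^sup>2\<close> over \<open>t\<close>; it is divisible by \<open>p\<close>, so it is \<open>0\<close> or \<open>p\<close>. Then
  \<open>S\<close> or \<open>T\<close> vanishes for all \<open>c\<close>, which is impossible since \<open>\<zeta> ^ m + \<zeta> ^ n \<noteq> 0\<close>.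
\<close>

section \<open>Evaluation of integer polynomials\<close>

definition int_poly_eval :: "int poly \<Rightarrow> complex \<Rightarrow> complex" where
  "int_poly_eval q z = poly (map_poly of_int q) z"

lemma int_poly_eval_pCons [simp]:
  "int_poly_eval (pCons a q) z = of_int a + z * int_poly_eval q z"
  by (simp add: int_poly_eval_def map_poly_pCons)

lemma int_poly_eval_0 [simp]: "int_poly_eval 0 z = 0"
  by (simp add: int_poly_eval_def)

lemma int_poly_eval_1 [simp]: "int_poly_eval 1 z = 1"
  by (simp add: one_pCons)

lemma int_poly_eval_add [simp]:
  "int_poly_eval (q + r) z = int_poly_eval q z + int_poly_eval r z"
  by (induction q r rule: poly_induct2) (simp_all add: algebra_simps)

lemma int_poly_eval_smult [simp]:
  "int_poly_eval (smult a q) z = of_int a * int_poly_eval q z"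
  by (induction q) (simp_all add: algebra_simps)

lemma int_poly_eval_minus [simp]: "int_poly_eval (- q) z = - int_poly_eval q z"
  using int_poly_eval_smult[of "-1" q z] by simp

lemma int_poly_eval_diff [simp]:
  "int_poly_eval (q - r) z = int_poly_eval q z - int_poly_eval r z"
  using int_poly_eval_add[of q "- r" z] by simp

lemma int_poly_eval_mult [simp]:
  "int_poly_eval (q * r) z = int_poly_eval q z * int_poly_eval r z"
  by (induction q) (simp_all add: algebra_simps)

lemma int_poly_eval_power [simp]: "int_poly_eval (q ^ n) z = int_poly_eval q z ^ n"
  by (induction n) simp_all

lemma int_poly_eval_monom [simp]: "int_poly_eval (monom a n) z = of_int a * z ^ n"
  by (induction n) (simp_all add: monom_Suc monom_0 algebra_simps)

lemma int_poly_eval_sum [simp]: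
  "int_poly_eval (\<Sum>i\<in>A. f i) z = (\<Sum>i\<in>A. int_poly_eval (f i) z)"
  by (induction A rule: infinite_finite_induct) simp_all

lemma int_poly_eval_pcompose [simp]:
  "int_poly_eval (pcompose q r) z = int_poly_eval q (int_poly_eval r z)"
  by (induction q) (simp_all add: pcompose_pCons)

lemma int_poly_eval_at_1 [simp]: "int_poly_eval q 1 = of_int (poly q 1)"
  by (induction q) simp_all

lemma cnj_int_poly_eval: "cnj (int_poly_eval q z) = int_poly_eval q (cnj z)"
  by (induction q) simp_all

lemma int_poly_eval_altdef:
  "int_poly_eval q z = (\<Sum>i\<le>degree q. of_int (coeff q i) * z ^ i)"
  by (simp add: int_poly_eval_def poly_altdef degree_map_poly coeff_map_poly)

lemma int_poly_eval_numeral [simp]: "int_poly_eval (numeral n) z = numeral n"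
  by (simp add: numeral_poly)

section \<open>Polynomial congruences modulo 2 and modulo \<open>p\<close>\<close>

text \<open>Frobenius modulo 2: cross terms are even and each coefficient is congruent to its
  square, so squaring \<open>q\<close> amounts to substituting \<open>X^2\<close>, which is
  \<open>monom 1 2\<close>.\<close>

lemma int_poly_square_cong_pcompose:
  "\<exists>r :: int poly. q\<^sup>2 = pcompose q (monom 1 2) + 2 * r"
proof (induction q)
  case 0
  then show ?case by (intro exI[of _ 0]) simp
next
  case (pCons a q)
  then obtain r where r: "q\<^sup>2 = pcompose q (monom 1 2) + 2 * r" by blast
  have "even (a * a - a)" by simp
  then obtain b where "a * a - a = 2 * b" by blast
  then have b: "[:a:]\<^sup>2 = [:a:] + 2 * [:b:]" by (simp add: power2_eq_square numeral_poly)
  have "pCons a q = [:a:] + monom 1 1 * q"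
    by (simp add: monom_Suc monom_0)
  then have "(pCons a q)\<^sup>2 = [:a:]\<^sup>2 + (monom 1 1)\<^sup>2 * q\<^sup>2 + 2 * ([:a:] * (monom 1 1 * q))"
    by (simp only: power2_sum power_mult_distrib mult.assoc)
  also have "\<dots> = pcompose (pCons a q) (monom 1 2) + 2 * ([:b:] + monom 1 2 * r + [:a:] * (monom 1 1 * q))"
  proof -
    have "A + 2 * B + M * (C + 2 * R) + 2 * Z = A + M * C + 2 * (B + M * R + Z)"
      for A B C M R Z :: "int poly" by (simp add: algebra_simps)
    moreover have "(monom 1 1 :: int poly)\<^sup>2 = monom 1 2" by (simp add: monom_power)
    ultimately show ?thesis unfolding r b pcompose_pCons by (simp only:)
  qed
  finally show ?case by blast
qed

text \<open>Modulo \<open>p\<close>, \<open>(1 - X)^p\<close> is \<open>1 - X^p\<close>, which is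
  \<open>1 - X\<close> times the geometric sum. The factor \<open>1 - X\<close> cancels because the
  constant \<open>p\<close> is a prime element of the polynomial ring and does not divide
  it.\<close>

lemma const_dvd_one_minus_X_power:
  fixes p :: nat
  assumes "prime p" "odd p"
  shows "[:int p:] dvd [:1, -1:] ^ (p - 1) - (\<Sum>i<p. monom 1 i)"
proof -
  let ?h = "[:1, -1:] ^ (p - 1) - (\<Sum>i<p. monom 1 i) :: int poly"
  have p0: "p > 0" using assms(1) prime_gt_0_nat by blast
  have geo: "[:1, -1:] * (\<Sum>i<n. monom 1 i) = 1 - (monom 1 n :: int poly)" for n
  proof -
    have "[:1, -1:] = 1 - (monom 1 1 :: int poly)" by (simp add: monom_Suc monom_0 one_pCons)
    moreover have "monom 1 i = (monom 1 1 :: int poly) ^ i" for i by (simp add: monom_power)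
    ultimately show ?thesis by (metis (no_types, lifting) one_diff_power_eq sum.cong)
  qed
  have pw: "[:1, -1:] ^ p = (\<Sum>k\<le>p. of_nat (p choose k) * (- monom 1 1 :: int poly) ^ k)"
  proof -
    have "[:1, -1:] = (- monom 1 1) + (1 :: int poly)"
      by (simp add: monom_Suc monom_0 one_pCons)
    then show ?thesis by (simp only: binomial_ring power_one mult_1_right)
  qed
  have "[:1, -1:] * ?h = [:1, -1:] ^ p - (1 - monom 1 p)"
    unfolding right_diff_distrib geo using p0 by (metis Suc_pred' power_Suc)
  also have "[:1, -1:] ^ p = 1 + (\<Sum>k\<in>{1..<p}. of_nat (p choose k) * (- monom 1 1 :: int poly) ^ k)
      + (- monom 1 1) ^ p"
  proof -
    have "{..p} = insert 0 (insert p {1..<p})" using p0 by auto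
    then show ?thesis unfolding pw using p0 by simp
  qed
  also have "(- monom 1 1 :: int poly) ^ p = - monom 1 p"
    using assms(2) by (simp add: monom_power)
  finally have eq: "[:1, -1:] * ?h = (\<Sum>k\<in>{1..<p}. of_nat (p choose k) * (- monom 1 1) ^ k)"
    by simp
  have "[:int p:] dvd [:1, -1:] * ?h"
    unfolding eq
  proof (rule dvd_sum)
    fix k assume "k \<in> {1..<p}"
    then have "p dvd (p choose k)"
      using assms(1) by (intro dvd_choose_prime) auto
    then have "int p dvd int (p choose k)" by simp
    then have "[:int p:] dvd (of_nat (p choose k) :: int poly)"
      by (simp add: of_nat_poly)
    then show "[:int p:] dvd of_nat (p choose k) * (- monom 1 1) ^ k" by simp
  qed
  moreover have "prime_elem [:int p:]"
    using assms(1) by (simp add: prime_elem_const_poly_iff)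
  moreover have "\<not> [:int p:] dvd [:1, -1:]"
    using assms(1) by (auto simp: const_poly_dvd_iff intro!: exI[of _ 0] dest: prime_gt_1_nat)
  ultimately show ?thesis
    using prime_elem_dvd_multD by blast
qed

section \<open>Cyclotomic integers as families of conjugates\<close>

locale odd_prime =
  fixes p :: nat
  assumes prime_p: "prime p" and odd_p: "odd p"
begin

lemma p_ge_3: "p \<ge> 3"
  using prime_p odd_p prime_ge_2_nat[of p] by (cases "p = 2") auto

lemma p_neq_0 [simp]: "p \<noteq> 0" using p_ge_3 by simp

lemma mod_p_nonneg [simp]: "0 \<le> m mod int p" using p_ge_3 by simp

section \<open>Powers of a primitive \<open>p\<close>-th root of unity\<close>

text \<open>Indexing by integers turns conjugation into negation of the index and the Galois action
  into its multiplication.\<close>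

definition \<zeta> :: "int \<Rightarrow> complex" where
  "\<zeta> m = cis (2 * pi * of_int m / of_nat p)"

lemma zeta_0 [simp]: "\<zeta> 0 = 1" by (simp add: \<zeta>_def)

lemma zeta_add: "\<zeta> (m + n) = \<zeta> m * \<zeta> n"
  by (simp add: \<zeta>_def cis_mult add_divide_distrib distrib_left)

lemma zeta_power: "\<zeta> m ^ n = \<zeta> (m * int n)"
  by (induction n) (simp_all add: zeta_add algebra_simps)

lemma cnj_zeta [simp]: "cnj (\<zeta> m) = \<zeta> (- m)"
  by (simp add: \<zeta>_def cis_cnj)

lemma zeta_neq_0 [simp]: "\<zeta> m \<noteq> 0" by (simp add: \<zeta>_def)

lemma zeta_minus: "\<zeta> (- m) * \<zeta> m = 1" "\<zeta> m * \<zeta> (- m) = 1"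
  by (simp_all flip: zeta_add)

lemma zeta_eq_1_iff: "\<zeta> m = 1 \<longleftrightarrow> int p dvd m"
proof
  assume "\<zeta> m = 1"
  then have "cos (2 * pi * of_int m / of_nat p) = 1"
    by (simp add: \<zeta>_def complex_eq_iff)
  then obtain x :: int where "2 * pi * of_int m / of_nat p = of_int x * 2 * pi"
    by (auto simp: cos_one_2pi_int)
  then have "of_int m = (of_int (x * int p) :: real)"
    by (simp add: field_simps)
  then have "m = x * int p" by linarith
  then show "int p dvd m" by simp
next
  assume "int p dvd m"
  then obtain x where "m = int p * x" by blast
  then have "2 * pi * of_int m / of_nat p = 2 * pi * of_int x" by simp
  then show "\<zeta> m = 1" by (simp add: \<zeta>_def cis_multiple_2pi)
qed

lemma zeta_cong: "[m = n] (mod int p) \<Longrightarrow> \<zeta> m = \<zeta> n"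
proof -
  assume "[m = n] (mod int p)"
  then have "\<zeta> (m - n) = 1" by (simp add: zeta_eq_1_iff cong_iff_dvd_diff)
  then show ?thesis using zeta_add[of "m - n" n] by simp
qed

lemma zeta_mod: "\<zeta> (m mod int p) = \<zeta> m"
  by (rule zeta_cong) simp

text \<open>The \<open>p\<close>-th power of \<open>\<zeta> m = - \<zeta> n\<close> would read
  \<open>1 = - 1\<close>, as \<open>p\<close> is odd.\<close>

lemma zeta_add_neq_0: "\<zeta> m + \<zeta> n \<noteq> 0"
proof
  assume "\<zeta> m + \<zeta> n = 0"
  then have "\<zeta> m = - \<zeta> n" by (simp add: eq_neg_iff_add_eq_0)
  then have "\<zeta> m ^ p = - (\<zeta> n ^ p)" using odd_p by simp
  moreover have "\<zeta> j ^ p = 1" for j by (simp add: zeta_power zeta_eq_1_iff)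
  ultimately show False by (simp add: complex_eq_iff)
qed

lemma sum_zeta: "(\<Sum>k\<in>{0..<p}. \<zeta> (int k * m)) = (if int p dvd m then of_nat p else 0)"
proof (cases "int p dvd m")
  case True
  then have "\<zeta> (int k * m) = 1" for k by (simp add: zeta_eq_1_iff)
  then show ?thesis using True by simp
next
  case False
  then have "\<zeta> m \<noteq> 1" by (simp add: zeta_eq_1_iff)
  moreover have "\<zeta> m ^ p = 1" by (simp add: zeta_power zeta_eq_1_iff)
  moreover have "(\<Sum>k\<in>{0..<p}. \<zeta> (int k * m)) = (\<Sum>k<p. \<zeta> m ^ k)"
    by (rule sum.cong) (auto simp: zeta_power mult.commute)
  ultimately show ?thesis using False by (simp add: geometric_sum)
qed

section \<open>Ring operations and Galois action on families of conjugates\<close>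

text \<open>
  An element of \<open>\<int>[\<zeta>]\<close> is represented by the family of its conjugates, indexed by the
  \<open>k\<close> prime to \<open>p\<close>; values at multiples of \<open>p\<close> are irrelevant. Carrying all conjugates
  along makes the irreducibility of the cyclotomic polynomial unnecessary. The number \<open>s\<close> is
  the image under \<open>\<zeta> \<mapsto> 1\<close>, which is determined by \<open>\<phi>\<close> only modulo \<open>p\<close>. Divisibility of
  \<open>\<phi>\<close> by \<open>d\<close> is expressed as integrality of \<open>\<lambda>k. \<phi> k / d\<close>.
\<close>

definition cyc_aug :: "(int \<Rightarrow> complex) \<Rightarrow> int \<Rightarrow> bool" where
  "cyc_aug \<phi> s \<longleftrightarrow>
     (\<exists>q. poly q 1 = s \<and> (\<forall>k. \<not> int p dvd k \<longrightarrow> \<phi> k = int_poly_eval q (\<zeta> k)))"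

definition cyc :: "(int \<Rightarrow> complex) \<Rightarrow> bool" where
  "cyc \<phi> \<longleftrightarrow> (\<exists>s. cyc_aug \<phi> s)"

lemma cyc_aug_cong:
  assumes "cyc_aug \<psi> s" "\<And>k. \<not> int p dvd k \<Longrightarrow> \<phi> k = \<psi> k"
  shows "cyc_aug \<phi> s"
  using assms unfolding cyc_aug_def by auto

lemma cyc_cong:
  assumes "cyc \<psi>" "\<And>k. \<not> int p dvd k \<Longrightarrow> \<phi> k = \<psi> k"
  shows "cyc \<phi>"
  using assms cyc_aug_cong unfolding cyc_def by blast

lemma cyc_augI:
  assumes "\<And>k. \<not> int p dvd k \<Longrightarrow> \<phi> k = int_poly_eval q (\<zeta> k)" "poly q 1 = s"
  shows "cyc_aug \<phi> s"
  using assms unfolding cyc_aug_def by blast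

lemma cyc_aug_add:
  assumes "cyc_aug \<phi> s" "cyc_aug \<psi> t"
  shows "cyc_aug (\<lambda>k. \<phi> k + \<psi> k) (s + t)"
proof -
  from assms obtain q r where "poly q 1 = s" "\<forall>k. \<not> int p dvd k \<longrightarrow> \<phi> k = int_poly_eval q (\<zeta> k)"
    "poly r 1 = t" "\<forall>k. \<not> int p dvd k \<longrightarrow> \<psi> k = int_poly_eval r (\<zeta> k)"
    unfolding cyc_aug_def by blast
  then show ?thesis by (intro cyc_augI[where q = "q + r"]) auto
qed

lemma cyc_aug_mult:
  assumes "cyc_aug \<phi> s" "cyc_aug \<psi> t"
  shows "cyc_aug (\<lambda>k. \<phi> k * \<psi> k) (s * t)"
proof -
  from assms obtain q r where "poly q 1 = s" "\<forall>k. \<not> int p dvd k \<longrightarrow> \<phi> k = int_poly_eval q (\<zeta> k)"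
    "poly r 1 = t" "\<forall>k. \<not> int p dvd k \<longrightarrow> \<psi> k = int_poly_eval r (\<zeta> k)"
    unfolding cyc_aug_def by blast
  then show ?thesis by (intro cyc_augI[where q = "q * r"]) auto
qed

lemma cyc_aug_of_int: "cyc_aug (\<lambda>k. of_int m) m"
  by (rule cyc_augI[where q = "[:m:]"]) auto

lemma cyc_aug_zeta: "cyc_aug (\<lambda>k. \<zeta> (k * m)) 1"
proof (rule cyc_augI[where q = "monom 1 (nat (m mod int p))"])
  fix k
  have "k * (m mod int p) mod int p = k * m mod int p" by (simp add: mod_mult_right_eq)
  then show "\<zeta> (k * m) = int_poly_eval (monom 1 (nat (m mod int p))) (\<zeta> k)"
    by (simp add: zeta_power) (metis zeta_mod)
qed (simp add: poly_monom)

lemma cyc_aug_sum: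
  assumes "\<And>i. i \<in> A \<Longrightarrow> cyc_aug (\<phi> i) (s i)"
  shows "cyc_aug (\<lambda>k. \<Sum>i\<in>A. \<phi> i k) (\<Sum>i\<in>A. s i)"
  using assms
proof (induction A rule: infinite_finite_induct)
  case (insert x F)
  then show ?case by (simp add: cyc_aug_add)
qed (use cyc_aug_of_int[of 0] in simp_all)

lemma cyc_aug_power:
  assumes "cyc_aug \<phi> s"
  shows "cyc_aug (\<lambda>k. \<phi> k ^ n) (s ^ n)"
  using cyc_aug_of_int[of 1] assms by (induction n) (simp_all add: cyc_aug_mult)

lemma cyc_aug_minus:
  assumes "cyc_aug \<phi> s"
  shows "cyc_aug (\<lambda>k. - \<phi> k) (- s)"
  using cyc_aug_mult[OF cyc_aug_of_int[of "-1"] assms] by simp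

lemma cyc_aug_diff:
  assumes "cyc_aug \<phi> s" "cyc_aug \<psi> t"
  shows "cyc_aug (\<lambda>k. \<phi> k - \<psi> k) (s - t)"
  using cyc_aug_add[OF assms(1) cyc_aug_minus[OF assms(2)]] by simp

lemma not_dvd_mult:
  "\<not> int p dvd h \<Longrightarrow> \<not> int p dvd k \<Longrightarrow> \<not> int p dvd h * k"
  using prime_p by (simp add: prime_dvd_mult_iff)

lemma not_dvd_2: "\<not> int p dvd 2"
  using p_ge_3 by (auto dest: zdvd_imp_le)

lemma dvd_4_mult_cancel: "int p dvd 4 * m \<Longrightarrow> int p dvd m"
  using not_dvd_mult[OF not_dvd_2, of "2 * m"] not_dvd_mult[OF not_dvd_2, of m] by auto

text \<open>Substituting \<open>X^h\<close>, with \<open>h\<close> reduced to a natural exponent,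
  realizes the automorphism \<open>\<zeta> \<mapsto> \<zeta> ^ h\<close> and keeps the value at
  1.\<close>

lemma cyc_aug_galois:
  assumes "cyc_aug \<phi> s" "\<not> int p dvd h"
  shows "cyc_aug (\<lambda>k. \<phi> (h * k)) s"
proof -
  obtain q where q: "poly q 1 = s" "\<forall>k. \<not> int p dvd k \<longrightarrow> \<phi> k = int_poly_eval q (\<zeta> k)"
    using assms(1) unfolding cyc_aug_def by blast
  show ?thesis
  proof (rule cyc_augI[where q = "pcompose q (monom 1 (nat (h mod int p)))"])
    fix k assume k: "\<not> int p dvd k"
    have "k * (h mod int p) mod int p = h * k mod int p"
      by (simp add: mod_mult_right_eq mult.commute)
    then have "\<zeta> k ^ nat (h mod int p) = \<zeta> (h * k)"
      by (simp add: zeta_power) (metis zeta_mod)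
    then show "\<phi> (h * k) = int_poly_eval (pcompose q (monom 1 (nat (h mod int p)))) (\<zeta> k)"
      using q(2) not_dvd_mult[OF assms(2) k] by simp
  qed (use q in \<open>simp add: poly_pcompose poly_monom\<close>)
qed

text \<open>Conjugation is the Galois action of \<open>-1\<close>, because the coefficients are
  integers.\<close>

lemma cyc_aug_cnj:
  assumes "cyc_aug \<phi> s"
  shows "cyc_aug (\<lambda>k. cnj (\<phi> k)) s"
proof -
  have "\<not> int p dvd -1" using p_ge_3 by simp
  from cyc_aug_galois[OF assms this] have "cyc_aug (\<lambda>k. \<phi> (- k)) s" by simp
  then show ?thesis
  proof (rule cyc_aug_cong)
    fix k assume "\<not> int p dvd k"
    then show "cnj (\<phi> k) = \<phi> (- k)"
      using assms unfolding cyc_aug_def by (auto simp: cnj_int_poly_eval)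
  qed
qed

lemma cyc_aug_periodic:
  assumes "cyc_aug \<phi> s" "\<not> int p dvd k" "[j = k] (mod int p)"
  shows "\<phi> j = \<phi> k"
proof -
  have "\<not> int p dvd j" using assms(2,3) by (simp add: cong_dvd_iff)
  with assms(1,2) zeta_cong[OF assms(3)] show ?thesis unfolding cyc_aug_def by metis
qed

lemma cyc_aug_imp_cyc: "cyc_aug \<phi> s \<Longrightarrow> cyc \<phi>" unfolding cyc_def by blast

lemma cyc_add: "cyc \<phi> \<Longrightarrow> cyc \<psi> \<Longrightarrow> cyc (\<lambda>k. \<phi> k + \<psi> k)"
  using cyc_aug_add unfolding cyc_def by blast
lemma cyc_mult: "cyc \<phi> \<Longrightarrow> cyc \<psi> \<Longrightarrow> cyc (\<lambda>k. \<phi> k * \<psi> k)"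
  using cyc_aug_mult unfolding cyc_def by blast
lemma cyc_diff: "cyc \<phi> \<Longrightarrow> cyc \<psi> \<Longrightarrow> cyc (\<lambda>k. \<phi> k - \<psi> k)"
  using cyc_aug_diff unfolding cyc_def by blast
lemma cyc_minus: "cyc \<phi> \<Longrightarrow> cyc (\<lambda>k. - \<phi> k)"
  using cyc_aug_minus unfolding cyc_def by blast
lemma cyc_cnj: "cyc \<phi> \<Longrightarrow> cyc (\<lambda>k. cnj (\<phi> k))"
  using cyc_aug_cnj unfolding cyc_def by blast
lemma cyc_power: "cyc \<phi> \<Longrightarrow> cyc (\<lambda>k. \<phi> k ^ n)"
  using cyc_aug_power unfolding cyc_def by blast
lemma cyc_of_int: "cyc (\<lambda>k. of_int m)"
  using cyc_aug_of_int unfolding cyc_def by blast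
lemma cyc_of_nat: "cyc (\<lambda>k. of_nat m)"
  using cyc_of_int[of "int m"] by simp
lemma cyc_numeral: "cyc (\<lambda>k. numeral m)"
  using cyc_of_int[of "numeral m"] by simp
lemma cyc_1: "cyc (\<lambda>k. 1)"
  using cyc_of_int[of 1] by simp
lemma cyc_zeta: "cyc (\<lambda>k. \<zeta> (k * m))"
  using cyc_aug_zeta unfolding cyc_def by blast
lemma cyc_sum: "(\<And>i. i \<in> A \<Longrightarrow> cyc (\<phi> i)) \<Longrightarrow> cyc (\<lambda>k. \<Sum>i\<in>A. \<phi> i k)"
  using cyc_aug_sum[of A \<phi>] unfolding cyc_def by metis

lemmas cyc_intros = cyc_add cyc_mult cyc_diff cyc_minus cyc_cnj cyc_power
  cyc_of_int cyc_of_nat cyc_numeral cyc_1 cyc_zeta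

section \<open>Traces modulo \<open>p\<close>\<close>

text \<open>Over all residues \<open>k\<close>, orthogonality leaves \<open>p\<close> times the sum
  of the coefficients at exponents divisible by \<open>p\<close>; the term at \<open>k = 0\<close>
  is \<open>s\<close> and has to be removed.\<close>

lemma trace_cyc_aug:
  assumes "cyc_aug \<phi> s"
  shows "\<exists>t::int. (\<Sum>k\<in>{1..<p}. \<phi> (int k)) = of_int (int p * t - s)"
proof -
  obtain q where q: "poly q 1 = s" "\<forall>k. \<not> int p dvd k \<longrightarrow> \<phi> k = int_poly_eval q (\<zeta> k)"
    using assms unfolding cyc_aug_def by blast
  have nd: "\<not> int p dvd int k" if "k \<in> {1..<p}" for k
    using that by (auto dest: nat_dvd_not_less)
  have "{0..<p} = insert 0 {1..<p}" using p_ge_3 by auto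
  then have "(\<Sum>k\<in>{0..<p}. int_poly_eval q (\<zeta> (int k)))
      = of_int s + (\<Sum>k\<in>{1..<p}. int_poly_eval q (\<zeta> (int k)))"
    using q(1) by simp
  also have "(\<Sum>k\<in>{1..<p}. int_poly_eval q (\<zeta> (int k))) = (\<Sum>k\<in>{1..<p}. \<phi> (int k))"
    using q(2) nd by (intro sum.cong) auto
  finally have 1: "(\<Sum>k\<in>{1..<p}. \<phi> (int k)) = (\<Sum>k\<in>{0..<p}. int_poly_eval q (\<zeta> (int k))) - of_int s"
    by simp
  have "(\<Sum>k\<in>{0..<p}. int_poly_eval q (\<zeta> (int k)))
      = (\<Sum>i\<le>degree q. \<Sum>k\<in>{0..<p}. of_int (coeff q i) * \<zeta> (int k * int i))"
    unfolding int_poly_eval_altdef by (subst sum.swap) (simp add: zeta_power)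
  also have "\<dots> = (\<Sum>i\<le>degree q. of_int (coeff q i) * (if int p dvd int i then of_nat p else 0))"
    by (simp only: sum_zeta flip: sum_distrib_left)
  also have "\<dots> = of_int (int p * (\<Sum>i\<le>degree q. if p dvd i then coeff q i else 0))"
    by (simp add: sum_distrib_left if_distrib mult.commute cong: if_cong)
  finally show ?thesis
    unfolding 1 of_int_diff
    by (intro exI[of _ "\<Sum>i\<le>degree q. if p dvd i then coeff q i else 0"]) (simp only:)
qed

text \<open>\<open>s - t\<close> is an augmentation of the zero family, whose trace is 0.\<close>

lemma cyc_aug_unique_mod:
  assumes "cyc_aug \<phi> s" "cyc_aug \<phi> t"
  shows "int p dvd s - t"
proof -
  have "cyc_aug (\<lambda>k. 0) (s - t)" using cyc_aug_diff[OF assms] by simp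
  from trace_cyc_aug[OF this] obtain u where "of_int (int p * u - (s - t)) = (0::complex)" by auto
  then have "int p * u - (s - t) = 0" by (simp only: of_int_eq_0_iff)
  then have "s - t = int p * u" by simp
  then show ?thesis by simp
qed

section \<open>Divisibility by 2\<close>

text \<open>
  The ring \<open>\<int>[\<zeta>] / 2\<close> is reduced, because squaring is there the automorphism \<open>\<zeta> \<mapsto> \<zeta>\<^sup>2\<close>.
\<close>

lemma cyc_div_2:
  assumes "cyc \<phi>" "cyc (\<lambda>k. (\<phi> k)\<^sup>2 / 2)"
  shows "cyc (\<lambda>k. \<phi> k / 2)"
proof -
  obtain q s where q: "poly q 1 = s" "\<forall>k. \<not> int p dvd k \<longrightarrow> \<phi> k = int_poly_eval q (\<zeta> k)"
    using assms(1) unfolding cyc_aug_def cyc_def by blast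
  obtain r where r: "q\<^sup>2 = pcompose q (monom 1 2) + 2 * r"
    using int_poly_square_cong_pcompose by blast
  have cr: "cyc (\<lambda>k. int_poly_eval r (\<zeta> k))" unfolding cyc_def cyc_aug_def by blast
  \<comment> \<open>The square is congruent to the conjugate \<open>\<phi> (2 * k)\<close> modulo
    2.\<close>
  have "cyc (\<lambda>k. \<phi> (2 * k) / 2)"
  proof (rule cyc_cong[OF cyc_diff[OF assms(2) cr]])
    fix k assume k: "\<not> int p dvd k"
    have "(\<phi> k)\<^sup>2 = int_poly_eval (q\<^sup>2) (\<zeta> k)" using q k by simp
    also have "\<dots> = int_poly_eval q (\<zeta> (2 * k)) + 2 * int_poly_eval r (\<zeta> k)"
      unfolding r by (simp add: zeta_power mult.commute)
    also have "int_poly_eval q (\<zeta> (2 * k)) = \<phi> (2 * k)"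
      using q not_dvd_mult[OF not_dvd_2 k] by simp
    finally show "\<phi> (2 * k) / 2 = (\<phi> k)\<^sup>2 / 2 - int_poly_eval r (\<zeta> k)"
      by (simp add: add_divide_distrib)
  qed
  then obtain s' where "cyc_aug (\<lambda>k. \<phi> (2 * k) / 2) s'" unfolding cyc_def by blast
  \<comment> \<open>\<open>h\<close> is the inverse of 2 modulo \<open>p\<close> and undoes the
    automorphism.\<close>
  moreover define h where "h = (int p + 1) div 2"
  have h: "2 * h = int p + 1" using odd_p unfolding h_def by presburger
  then have "\<not> int p dvd h" 
    by (metis dvd_add_right_iff dvd_mult dvd_refl int_dvd_int_iff nat_dvd_1_iff_1 of_nat_1 prime_p not_prime_1)
  ultimately have "cyc_aug (\<lambda>k. \<phi> (2 * (h * k)) / 2) s'" by (rule cyc_aug_galois)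
  then show ?thesis
  proof (rule cyc_cong[OF cyc_aug_imp_cyc])
    fix k assume k: "\<not> int p dvd k"
    have "2 * (h * k) = int p * k + k" using arg_cong[OF h, of "\<lambda>x. x * k"] by (simp add: algebra_simps)
    then have "[2 * (h * k) = k] (mod int p)" by (simp add: cong_def)
    then show "\<phi> k / 2 = \<phi> (2 * (h * k)) / 2"
      using assms(1) k cyc_aug_periodic unfolding cyc_def by metis
  qed
qed

section \<open>Divisibility by \<open>1 - \<zeta>\<close> and by \<open>p\<close>\<close>

lemma zeta_neq_1: "\<not> int p dvd k \<Longrightarrow> 1 - \<zeta> k \<noteq> 0"
  using zeta_eq_1_iff by auto

lemma sum_powers_zeta:
  assumes "\<not> int p dvd k"
  shows "(\<Sum>i<p. \<zeta> k ^ i) = 0"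
  using sum_zeta[of k] assms by (simp add: zeta_power mult.commute atLeast0LessThan)

text \<open>Division by \<open>1 - X\<close> leaves the remainder \<open>s\<close>, a multiple of
  \<open>p\<close>. In turn \<open>p\<close> is a multiple of \<open>1 - \<zeta> k\<close>, since
  the geometric sum \<open>\<Phi>\<close> has value \<open>p\<close> at 1 and vanishes at
  \<open>\<zeta> k\<close>.\<close>

lemma cyc_div_pi:
  assumes "cyc_aug \<phi> s" "int p dvd s"
  shows "cyc (\<lambda>k. \<phi> k / (1 - \<zeta> k))"
proof -
  have div: "\<exists>r. q = [:poly q 1:] + [:1, -1:] * r" for q :: "int poly"
  proof -
    have "poly (q - [:poly q 1:]) 1 = 0" by simp
    then have "[:-1, 1:] dvd q - [:poly q 1:]" by (simp only: poly_eq_0_iff_dvd)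
    then obtain r where "q - [:poly q 1:] = [:-1, 1:] * r" by (rule dvdE)
    then have "q = [:poly q 1:] + [:1, -1:] * (- r)" by (simp add: algebra_simps)
    then show ?thesis by blast
  qed
  define \<Phi> where "\<Phi> = (\<Sum>i<p. monom 1 i :: int poly)"
  have \<Phi>1: "poly \<Phi> 1 = int p" by (simp add: \<Phi>_def poly_sum poly_monom)
  obtain u where u: "\<Phi> = [:int p:] + [:1, -1:] * u" using div[of \<Phi>] \<Phi>1 by auto
  obtain q where q: "poly q 1 = s" "\<forall>k. \<not> int p dvd k \<longrightarrow> \<phi> k = int_poly_eval q (\<zeta> k)"
    using assms unfolding cyc_aug_def by blast
  obtain r where r: "q = [:s:] + [:1, -1:] * r" using div[of q] q by auto
  obtain t where t: "s = int p * t" using assms(2) by blast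
  have "cyc_aug (\<lambda>k. \<phi> k / (1 - \<zeta> k)) (poly (r - smult t u) 1)"
  proof (rule cyc_augI[OF _ refl])
    fix k assume k: "\<not> int p dvd k"
    have "0 = int_poly_eval \<Phi> (\<zeta> k)" using sum_powers_zeta[OF k] by (simp add: \<Phi>_def)
    then have 1: "of_nat p = - (1 - \<zeta> k) * int_poly_eval u (\<zeta> k)"
      by (simp add: u algebra_simps)
    have "\<phi> k = of_nat p * of_int t + (1 - \<zeta> k) * int_poly_eval r (\<zeta> k)"
      using q(2) k by (simp add: r t algebra_simps)
    then show "\<phi> k / (1 - \<zeta> k) = int_poly_eval (r - smult t u) (\<zeta> k)"
      unfolding 1 using zeta_neq_1[OF k] by (simp add: field_simps)
  qed
  then show ?thesis by (rule cyc_aug_imp_cyc)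
qed

text \<open>If \<open>(1 - X)^(p - 1)\<close> is the geometric sum plus \<open>p * r\<close>, the
  values at 1 show that \<open>r\<close> is \<open>-1\<close> there. So \<open>p\<close> is
  \<open>(1 - \<zeta>) ^ (p - 1)\<close> up to a factor prime to \<open>1 - \<zeta>\<close>.\<close>

lemma cyc_pi_power_div_p: "\<exists>s. cyc_aug (\<lambda>k. (1 - \<zeta> k) ^ (p - 1) / of_nat p) s \<and> \<not> int p dvd s"
proof -
  obtain r where r: "[:1, -1:] ^ (p - 1) - (\<Sum>i<p. monom 1 i) = [:int p:] * r"
    using const_dvd_one_minus_X_power[OF prime_p odd_p] by blast
  have "poly ([:1, -1:] ^ (p - 1) - (\<Sum>i<p. monom 1 i)) (1::int) = - int p"
    using p_ge_3 by (simp add: poly_sum poly_monom)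
  then have "int p * poly r 1 = int p * (-1)" unfolding r by simp
  then have r1: "poly r 1 = -1" by (subst (asm) mult_cancel_left) simp
  have "cyc_aug (\<lambda>k. (1 - \<zeta> k) ^ (p - 1) / of_nat p) (-1)"
  proof (rule cyc_augI[where q = r, OF _ r1])
    fix k assume k: "\<not> int p dvd k"
    have "int_poly_eval ([:1, -1:] ^ (p - 1) - (\<Sum>i<p. monom 1 i)) (\<zeta> k) = (1 - \<zeta> k) ^ (p - 1)"
      using sum_powers_zeta[OF k] by simp
    then show "(1 - \<zeta> k) ^ (p - 1) / of_nat p = int_poly_eval r (\<zeta> k)"
      unfolding r by simp (metis nonzero_mult_div_cancel_left of_nat_eq_0_iff p_neq_0)
  qed
  then show ?thesis using p_ge_3 by (metis dvd_minus_iff int_dvd_int_iff nat_dvd_1_iff_1 not_prime_1 of_nat_1 prime_p)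
qed

lemma cnj_one_minus_zeta: "cnj (1 - \<zeta> k) = - \<zeta> (- k) * (1 - \<zeta> k)"
  using zeta_minus(1)[of k] by (simp add: algebra_simps)

lemma cnj_one_minus_zeta_power:
  "cnj (1 - \<zeta> k) ^ n = (-1) ^ n * \<zeta> (- (k * int n)) * (1 - \<zeta> k) ^ n"
proof -
  have "cnj (1 - \<zeta> k) ^ n = (- \<zeta> (- k)) ^ n * (1 - \<zeta> k) ^ n"
    by (simp only: cnj_one_minus_zeta power_mult_distrib)
  also have "(- \<zeta> (- k)) ^ n = (-1) ^ n * \<zeta> (- (k * int n))"
    by (subst power_minus) (simp add: zeta_power)
  finally show ?thesis .
qed

text \<open>
  Complex conjugation fixes the prime \<open>1 - \<zeta>\<close> up to a unit, so it divides \<open>F\<close> and its conjugate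
  equally often, and \<open>p\<close> is \<open>(1 - \<zeta>) ^ (p - 1)\<close> up to a factor prime to it.
\<close>

lemma cyc_div_pi_power:
  assumes F: "cyc F" "\<And>k. \<not> int p dvd k \<Longrightarrow> F k * cnj (F k) = 4 * of_nat p"
    and "2 * j \<le> p - 1"
  shows "cyc (\<lambda>k. F k / (1 - \<zeta> k) ^ j)"
  using assms(3)
proof (induction j)
  case 0
  then show ?case using F(1) by simp
next
  case (Suc j)
  then obtain s where s: "cyc_aug (\<lambda>k. F k / (1 - \<zeta> k) ^ j) s" unfolding cyc_def by auto
  obtain u where u: "cyc_aug (\<lambda>k. (1 - \<zeta> k) ^ (p - 1) / of_nat p) u" "\<not> int p dvd u"
    using cyc_pi_power_div_p by blast
  let ?n = "p - 1 - 2 * j"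
  have n: "?n > 0" using Suc.prems by simp
  \<comment> \<open>Two augmentations of the same element are compared. Here it is read off the
    factors; \<open>s\<close> occurs twice because conjugation preserves it.\<close>
  have L: "cyc_aug (\<lambda>k. F k / (1 - \<zeta> k) ^ j * cnj (F k / (1 - \<zeta> k) ^ j)
      * ((1 - \<zeta> k) ^ (p - 1) / of_nat p)) (s * s * u)"
    by (intro cyc_aug_mult cyc_aug_cnj s u)
  have pi1: "cyc_aug (\<lambda>k. 1 - \<zeta> k) 0"
    using cyc_aug_diff[OF cyc_aug_of_int[of 1] cyc_aug_zeta[of 1]] by simp
  \<comment> \<open>The closed form of the element retains a positive power of
    \<open>1 - \<zeta> k\<close>, so its augmentation is 0.\<close>
  have R: "cyc_aug (\<lambda>k. of_int (4 * (-1) ^ j) * \<zeta> (k * int j) * (1 - \<zeta> k) ^ ?n)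
      (4 * (-1) ^ j * 1 * 0 ^ ?n)"
    by (intro cyc_aug_mult cyc_aug_power cyc_aug_of_int cyc_aug_zeta pi1)
  have "cyc_aug (\<lambda>k. F k / (1 - \<zeta> k) ^ j * cnj (F k / (1 - \<zeta> k) ^ j)
      * ((1 - \<zeta> k) ^ (p - 1) / of_nat p)) 0"
  proof (rule cyc_aug_cong)
    show "cyc_aug (\<lambda>k. of_int (4 * (-1) ^ j) * \<zeta> (k * int j) * (1 - \<zeta> k) ^ ?n) 0"
      using R by (simp only: zero_power[OF n] mult_zero_right)
    fix k assume k: "\<not> int p dvd k"
    define P where "P = 1 - \<zeta> k"
    have P: "P \<noteq> 0" using zeta_neq_1[OF k] by (simp add: P_def)
    have pw: "P ^ (p - 1) = P ^ j * P ^ j * P ^ ?n"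
      using n by (simp flip: power_add)
    have cP: "cnj P ^ j = (-1) ^ j * \<zeta> (- k * int j) * P ^ j"
      unfolding P_def by (simp only: cnj_one_minus_zeta_power) simp
    have z: "\<zeta> (k * int j) * \<zeta> (- k * int j) = 1" using zeta_minus[of "k * int j"] by simp
    have m: "((-1)::complex) ^ j * (-1) ^ j = 1" by (simp flip: power_add)
    have "F k / P ^ j * cnj (F k / P ^ j) * (P ^ (p - 1) / of_nat p)
        = (F k * cnj (F k)) * P ^ (p - 1) / (P ^ j * cnj P ^ j * of_nat p)"
      by simp
    also have "\<dots> = 4 * P ^ ?n / ((-1) ^ j * \<zeta> (- k * int j))"
      using P unfolding F(2)[OF k] pw cP by (simp add: divide_simps)
    also have "\<dots> = 4 * P ^ ?n * (((-1) ^ j * (-1) ^ j) * (\<zeta> (k * int j) * \<zeta> (- k * int j)))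
        / ((-1) ^ j * \<zeta> (- k * int j))"
      unfolding z m by simp
    also have "\<dots> = 4 * (-1) ^ j * \<zeta> (k * int j) * P ^ ?n"
      by (simp add: divide_simps)
    finally show "F k / (1 - \<zeta> k) ^ j * cnj (F k / (1 - \<zeta> k) ^ j) * ((1 - \<zeta> k) ^ (p - 1) / of_nat p)
        = of_int (4 * (-1) ^ j) * \<zeta> (k * int j) * (1 - \<zeta> k) ^ ?n"
      by (simp add: P_def)
  qed
  from cyc_aug_unique_mod[OF L this] have "int p dvd s * s * u" by simp
  then have "int p dvd s" using u(2) prime_p by (simp add: prime_dvd_mult_iff)
  from cyc_div_pi[OF s this] show ?case by (simp add: mult.commute)
qed

text \<open>Each of \<open>F\<close> and \<open>H\<close> is divisible by
  \<open>(1 - \<zeta>) ^ m\<close> with \<open>m = (p - 1) div 2\<close>, and \<open>p\<close>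
  divides the product \<open>(1 - \<zeta>) ^ (p - 1)\<close> of the two powers.\<close>

lemma cyc_mult_cnj_div_p:
  assumes "cyc F" "\<And>k. \<not> int p dvd k \<Longrightarrow> F k * cnj (F k) = 4 * of_nat p"
    and "cyc H" "\<And>k. \<not> int p dvd k \<Longrightarrow> H k * cnj (H k) = 4 * of_nat p"
  shows "cyc (\<lambda>k. F k * cnj (H k) / of_nat p)"
proof -
  define m where "m = (p - 1) div 2"
  have m: "2 * m = p - 1" using odd_p by (simp add: m_def)
  have FH: "cyc (\<lambda>k. F k / (1 - \<zeta> k) ^ m)" "cyc (\<lambda>k. H k / (1 - \<zeta> k) ^ m)"
    using assms m by (auto intro!: cyc_div_pi_power)
  obtain s where s: "cyc_aug (\<lambda>k. (1 - \<zeta> k) ^ (p - 1) / of_nat p) s"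
    using cyc_pi_power_div_p by blast
  \<comment> \<open>The sign and the power of \<open>\<zeta>\<close> turn one factor
    \<open>(1 - \<zeta> k) ^ m\<close> into its conjugate, which cancels the denominator below
    \<open>H\<close>.\<close>
  have "cyc (\<lambda>k. of_int ((-1) ^ m) * \<zeta> (k * (- int m)) * (F k / (1 - \<zeta> k) ^ m)
      * cnj (H k / (1 - \<zeta> k) ^ m) * ((1 - \<zeta> k) ^ (p - 1) / of_nat p))"
    by (intro cyc_intros FH cyc_aug_imp_cyc[OF s])
  then show ?thesis
  proof (rule cyc_cong)
    fix k assume k: "\<not> int p dvd k"
    define P where "P = 1 - \<zeta> k"
    have P: "P \<noteq> 0" using zeta_neq_1[OF k] by (simp add: P_def)
    have cP: "cnj P ^ m = (-1) ^ m * \<zeta> (k * (- int m)) * P ^ m"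
      unfolding P_def by (simp only: cnj_one_minus_zeta_power) simp
    have pw: "P ^ (p - 1) = P ^ m * P ^ m" by (metis m mult_2 power_add)
    have "(-1) ^ m * \<zeta> (k * (- int m)) * (F k / P ^ m) * cnj (H k / P ^ m) * (P ^ (p - 1) / of_nat p)
      = ((-1) ^ m * \<zeta> (k * (- int m)) * P ^ m) * F k * cnj (H k) / (cnj P ^ m * of_nat p)"
      unfolding pw using P by (simp add: divide_simps)
    also have "\<dots> = F k * cnj (H k) / of_nat p"
      using P unfolding cP[symmetric] by simp
    finally show "F k * cnj (H k) / of_nat p = of_int ((-1) ^ m) * \<zeta> (k * (- int m)) * (F k / (1 - \<zeta> k) ^ m)
      * cnj (H k / (1 - \<zeta> k) ^ m) * ((1 - \<zeta> k) ^ (p - 1) / of_nat p)"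
      by (simp add: P_def)
  qed
qed

text \<open>As \<open>p * p = 8 * t + 1\<close>, the quotient \<open>\<phi> / p\<close> equals
  \<open>p * \<phi> - t * (8 * \<phi> / p)\<close>. This removes the powers of 2 that arise when
  \<open>S\<close> and \<open>T\<close> are expressed through \<open>S + T\<close> and
  \<open>S - T\<close>.\<close>

lemma cyc_div_p_of_8:
  assumes "cyc \<phi>" "cyc (\<lambda>k. 8 * \<phi> k / of_nat p)"
  shows "cyc (\<lambda>k. \<phi> k / of_nat p)"
proof -
  obtain n where n: "p = 2 * n + 1" using odd_p oddE by blast
  have "even (n * (n + 1))" by simp
  then obtain t where t: "n * (n + 1) = 2 * t" by blast
  have "p * p = 8 * t + 1" using t unfolding n by (simp add: algebra_simps)
  then have pt: "(of_nat p * of_nat p :: complex) = 8 * of_nat t + 1"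
    by (metis of_nat_mult of_nat_add of_nat_1 of_nat_numeral)
  have "cyc (\<lambda>k. of_nat p * \<phi> k - of_nat t * (8 * \<phi> k / of_nat p))"
    by (intro cyc_intros assms)
  then show ?thesis
  proof (rule cyc_cong)
    fix k
    have "of_nat p * \<phi> k - of_nat t * (8 * \<phi> k / of_nat p)
        = (of_nat p * of_nat p * \<phi> k - 8 * of_nat t * \<phi> k) / of_nat p"
      by (simp add: field_simps)
    also have "\<dots> = \<phi> k / of_nat p" unfolding pt by (simp add: algebra_simps)
    finally show "\<phi> k / of_nat p = of_nat p * \<phi> k - of_nat t * (8 * \<phi> k / of_nat p)" by simp
  qed
qed

lemma not_dvd_less: "k \<in> {1..<p} \<Longrightarrow> \<not> int p dvd int k"
  by (auto dest: nat_dvd_not_less)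

section \<open>Families with small real or natural values\<close>

text \<open>
  The traces of the even powers are nonnegative integers and do not increase with the exponent,
  hence two consecutive ones agree.
\<close>

lemma cyc_bounded_imp_trivial:
  assumes "cyc \<gamma>"
    and real: "\<And>k. k \<in> {1..<p} \<Longrightarrow> \<gamma> (int k) = of_real (g k)"
    and bound: "\<And>k. k \<in> {1..<p} \<Longrightarrow> \<bar>g k\<bar> \<le> 1"
    and "k \<in> {1..<p}"
  shows "g k = 0 \<or> \<bar>g k\<bar> = 1"
proof -
  define tr where "tr n = (\<Sum>k\<in>{1..<p}. ((g k)\<^sup>2) ^ n)" for n
  have "\<exists>m::nat. tr n = real m" for n
  proof -
    obtain s where "cyc_aug (\<lambda>k. ((\<gamma> k)\<^sup>2) ^ n) s"
      using cyc_power[OF cyc_power[OF assms(1)]] unfolding cyc_def by blast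
    from trace_cyc_aug[OF this] obtain t where
      "(\<Sum>k\<in>{1..<p}. ((\<gamma> (int k))\<^sup>2) ^ n) = of_int t" by blast
    moreover have "(\<Sum>k\<in>{1..<p}. ((\<gamma> (int k))\<^sup>2) ^ n) = of_real (tr n)"
      unfolding tr_def by (simp add: real)
    ultimately have "tr n = of_int t" by (metis of_real_eq_iff of_real_of_int_eq)
    moreover have "tr n \<ge> 0" unfolding tr_def by (intro sum_nonneg) simp
    ultimately show ?thesis by (metis of_int_0_le_iff of_int_of_nat_eq zero_le_imp_eq_int)
  qed
  then obtain m where m: "\<And>n. tr n = real (m n)" by metis
  obtain n where n: "\<And>i. m n \<le> m i" using ex_has_least_nat[of "\<lambda>_. True" 0 m] by blast
  have le: "((g i)\<^sup>2) ^ Suc n \<le> ((g i)\<^sup>2) ^ n" if "i \<in> {1..<p}" for i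
    using bound[OF that] by (intro power_decreasing) (auto simp: abs_square_le_1)
  have "tr n \<le> tr (Suc n)" using n[of "Suc n"] by (simp add: m)
  then have "(\<Sum>i\<in>{1..<p}. ((g i)\<^sup>2) ^ n - ((g i)\<^sup>2) ^ Suc n) \<le> 0"
    by (simp add: tr_def sum_subtractf)
  moreover have "(\<Sum>i\<in>{1..<p}. ((g i)\<^sup>2) ^ n - ((g i)\<^sup>2) ^ Suc n) \<ge> 0"
    using le by (intro sum_nonneg) auto
  ultimately have "(\<Sum>i\<in>{1..<p}. ((g i)\<^sup>2) ^ n - ((g i)\<^sup>2) ^ Suc n) = 0" by linarith
  then have "\<forall>i\<in>{1..<p}. ((g i)\<^sup>2) ^ n - ((g i)\<^sup>2) ^ Suc n = 0"
    using le by (subst (asm) sum_nonneg_eq_0_iff) auto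
  with assms(4) have "((g k)\<^sup>2) ^ n * (1 - (g k)\<^sup>2) = 0" by (auto simp: algebra_simps)
  then have "(g k)\<^sup>2 ^ n = 0 \<or> (g k)\<^sup>2 = 1" by auto
  then show ?thesis by (auto simp: power2_eq_1_iff)
qed

text \<open>The trace of the \<open>(p - 1)\<close>-th power is 0 modulo \<open>p\<close>. By Fermat
  it is congruent to the number of \<open>k\<close> with \<open>v k\<close> prime to
  \<open>p\<close>; that number is below \<open>p\<close>, so it is 0.\<close>

lemma dvd_nat_values_of_dvd_aug:
  fixes v :: "nat \<Rightarrow> nat"
  assumes "cyc_aug \<phi> s" "int p dvd s"
    and v: "\<And>k. k \<in> {1..<p} \<Longrightarrow> \<phi> (int k) = of_nat (v k)"
    and "k \<in> {1..<p}"
  shows "p dvd v k"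
proof -
  let ?A = "{k\<in>{1..<p}. \<not> p dvd v k}"
  obtain t where "(\<Sum>k\<in>{1..<p}. \<phi> (int k) ^ (p - 1)) = of_int (int p * t - s ^ (p - 1))"
    using trace_cyc_aug[OF cyc_aug_power[OF assms(1)]] by blast
  moreover have "(\<Sum>k\<in>{1..<p}. \<phi> (int k) ^ (p - 1)) = of_int (int (\<Sum>k\<in>{1..<p}. v k ^ (p - 1)))"
    using v by simp
  ultimately have "int (\<Sum>k\<in>{1..<p}. v k ^ (p - 1)) = int p * t - s ^ (p - 1)"
    by (metis of_int_eq_iff)
  moreover have "int p dvd s ^ (p - 1)" using assms(2) p_ge_3 by (simp add: dvd_power_same dvd_trans)
  ultimately have "int p dvd int (\<Sum>k\<in>{1..<p}. v k ^ (p - 1))" by simp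
  then have dv: "p dvd (\<Sum>k\<in>{1..<p}. v k ^ (p - 1))" by (simp only: int_dvd_int_iff)
  have "[(\<Sum>k\<in>{1..<p}. v k ^ (p - 1)) = (\<Sum>k\<in>{1..<p}. if p dvd v k then 0 else 1)] (mod p)"
  proof (rule cong_sum)
    fix k
    have "p dvd v k \<Longrightarrow> p dvd v k ^ (p - 1)" using p_ge_3 by (auto intro: dvd_trans[OF _ dvd_power])
    then show "[v k ^ (p - 1) = (if p dvd v k then 0 else 1)] (mod p)"
      using fermat_theorem[OF prime_p, of "v k"] by (auto simp: cong_0_iff)
  qed
  also have "(\<Sum>k\<in>{1..<p}. if p dvd v k then 0 else 1) = card ?A"
  proof -
    have "card ?A = (\<Sum>k\<in>{1..<p}. if \<not> p dvd v k then 1 else 0)"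
      unfolding card_eq_sum by (rule sum.inter_filter) simp
    also have "\<dots> = (\<Sum>k\<in>{1..<p}. if p dvd v k then 0 else 1)" by (rule sum.cong) auto
    finally show ?thesis by simp
  qed
  finally have "p dvd card ?A" using dv cong_dvd_iff by blast
  moreover have "card ?A \<le> card {1..<p}" by (rule card_mono) auto
  then have "card ?A < p" using p_ge_3 by simp
  ultimately have "card ?A = 0" using nat_dvd_not_less by blast
  then have "?A = {}" by simp
  with assms(4) show ?thesis by blast
qed

section \<open>The norm of \<open>S\<close> modulo 2\<close>

text \<open>
  Modulo 2, reducedness gives first \<open>S * cnj D = 0\<close> and then \<open>D * cnj e = 0\<close>, where \<open>D = S + T\<close>
  and \<open>e = a + b\<close>; the norm of \<open>S\<close> is a combination of these two and their conjugates.
\<close>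

lemma cyc_norm_half:
  assumes cyc: "cyc S" "cyc T" "cyc a" "cyc b"
    and h1: "\<And>k. \<not> int p dvd k \<Longrightarrow> S k * cnj (S k) + T k * cnj (T k) = 4 * of_nat p"
    and h2: "\<And>k. \<not> int p dvd k \<Longrightarrow> S k * cnj (T k) + T k * cnj (S k) = 0"
    and h3: "\<And>k. \<not> int p dvd k \<Longrightarrow>
        (S k - 2 * a k) * cnj (S k - 2 * a k) + (T k - 2 * b k) * cnj (T k - 2 * b k) = 4 * of_nat p"
    and h4: "\<And>k. \<not> int p dvd k \<Longrightarrow>
        (S k - 2 * a k) * cnj (T k - 2 * b k) = (T k - 2 * b k) * cnj (S k - 2 * a k)"
  shows "cyc (\<lambda>k. S k * cnj (S k) / 2)"
proof -
  define D where "D k = S k + T k" for k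
  define e where "e k = a k + b k" for k
  have De: "cyc D" "cyc e" unfolding D_def e_def by (intro cyc_intros cyc)+
  have DD: "D k * cnj (D k) = 4 * of_nat p" if "\<not> int p dvd k" for k
  proof -
    have "D k * cnj (D k) = (S k * cnj (S k) + T k * cnj (T k)) + (S k * cnj (T k) + T k * cnj (S k))"
      by (simp add: D_def algebra_simps)
    then show ?thesis unfolding h1[OF that] h2[OF that] by simp
  qed
  have A: "cyc (\<lambda>k. S k * cnj (D k) / 2)"
  proof (rule cyc_div_2)
    show "cyc (\<lambda>k. S k * cnj (D k))" by (intro cyc_intros cyc De)
    \<comment> \<open>This is half of the square: the norm of \<open>D\<close> contributes
      \<open>4 * p\<close>, and the cross term vanishes by \<open>h2\<close>.\<close>
    have "cyc (\<lambda>k. 2 * of_nat p * (S k * cnj (S k)) + S k * cnj (D k) * (S k * cnj (T k)))"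
      by (intro cyc_intros cyc De)
    then show "cyc (\<lambda>k. (S k * cnj (D k))\<^sup>2 / 2)"
    proof (rule cyc_cong)
      fix k assume k: "\<not> int p dvd k"
      have "(S k * cnj (D k))\<^sup>2 = S k * cnj (S k) * (D k * cnj (D k))
          + 2 * (S k * cnj (D k) * (S k * cnj (T k))) - S k * cnj (D k) * (S k * cnj (T k) + T k * cnj (S k))"
        by (simp add: D_def power2_eq_square algebra_simps)
      then show "(S k * cnj (D k))\<^sup>2 / 2 = 2 * of_nat p * (S k * cnj (S k)) + S k * cnj (D k) * (S k * cnj (T k))"
        unfolding DD[OF k] h2[OF k] by (simp add: add_divide_distrib)
    qed
  qed
  then have A': "cyc (\<lambda>k. cnj (S k) * D k / 2)" using cyc_cnj by fastforce
  define Q where "Q k = a k * cnj (a k) + b k * cnj (b k) + T k * cnj (a k) + cnj (S k) * b k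
      + a k * cnj (b k) - b k * cnj (a k)" for k
  define W where "W k = S k * cnj (b k) + cnj (S k) * b k + a k * cnj (a k) + b k * cnj (b k)" for k
  have QW: "cyc Q" "cyc W" unfolding Q_def W_def by (intro cyc_intros cyc)+
  \<comment> \<open>Obtained by halving the difference of \<open>h1\<close> and
    \<open>h3\<close>.\<close>
  have Y: "S k * cnj (e k) + cnj (S k) * e k + D k * cnj (b k) + cnj (D k) * b k = 2 * W k"
    if "\<not> int p dvd k" for k
  proof -
    have "2 * (S k * cnj (e k) + cnj (S k) * e k + D k * cnj (b k) + cnj (D k) * b k - 2 * W k) =
      (S k * cnj (S k) + T k * cnj (T k)) -
      ((S k - 2 * a k) * cnj (S k - 2 * a k) + (T k - 2 * b k) * cnj (T k - 2 * b k))"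
      by (simp add: D_def e_def W_def algebra_simps)
    also have "\<dots> = 0" unfolding h3[OF that] h1[OF that] by simp
    finally show ?thesis by (simp only: mult_eq_0_iff) simp
  qed
  \<comment> \<open>Obtained by halving a combination of all four relations; modulo 2 it reduces the
    norm of \<open>S\<close> to products with \<open>D\<close>.\<close>
  have X: "S k * cnj (S k) = S k * cnj (D k) - D k * cnj (e k) - cnj (D k) * e k + 2 * Q k"
    if "\<not> int p dvd k" for k
  proof -
    have "2 * (S k * cnj (D k) - D k * cnj (e k) - cnj (D k) * e k + 2 * Q k - S k * cnj (S k)) =
      ((S k - 2 * a k) * cnj (T k - 2 * b k) - (T k - 2 * b k) * cnj (S k - 2 * a k))
      + (S k * cnj (T k) + T k * cnj (S k))
      + (((S k - 2 * a k) * cnj (S k - 2 * a k) + (T k - 2 * b k) * cnj (T k - 2 * b k))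
          - (S k * cnj (S k) + T k * cnj (T k)))"
      by (simp add: D_def e_def Q_def algebra_simps)
    also have "\<dots> = 0" unfolding h1[OF that] h2[OF that] h3[OF that] h4[OF that] by simp
    finally show ?thesis by (simp only: mult_eq_0_iff) simp
  qed
  have B: "cyc (\<lambda>k. D k * cnj (e k) / 2)"
  proof (rule cyc_div_2)
    show "cyc (\<lambda>k. D k * cnj (e k))" by (intro cyc_intros De)
    \<comment> \<open>Half of the square, found by adding \<open>D k * cnj (S k)\<close> times
      relation \<open>Y\<close> and \<open>D k * cnj (e k)\<close> times relation \<open>X\<close>.
      Each term left has an explicit factor 2 or is even by \<open>A\<close>, \<open>A'\<close> or
      \<open>DD\<close>.\<close>
    have "cyc (\<lambda>k. (cnj (S k) * D k / 2) * (cnj (S k) * e k + D k * cnj (b k)) - W k * D k * cnj (S k)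
        + 2 * of_nat p * (cnj (S k) * b k) - 2 * of_nat p * (e k * cnj (e k))
        + D k * cnj (e k) * (S k * cnj (D k) / 2 + Q k))"
      by (intro cyc_intros cyc De A A' QW)
    then show "cyc (\<lambda>k. (D k * cnj (e k))\<^sup>2 / 2)"
    proof (rule cyc_cong)
      fix k assume k: "\<not> int p dvd k"
      have "cnj (S k) * D k * (cnj (S k) * e k + D k * cnj (b k)) - 2 * (W k * D k * cnj (S k))
        + D k * cnj (D k) * (cnj (S k) * b k) - D k * cnj (D k) * (e k * cnj (e k))
        + D k * cnj (e k) * (S k * cnj (D k) + 2 * Q k)
        = (D k * cnj (e k))\<^sup>2
        + D k * cnj (S k) * ((S k * cnj (e k) + cnj (S k) * e k + D k * cnj (b k) + cnj (D k) * b k) - 2 * W k)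
        + D k * cnj (e k) * ((S k * cnj (D k) - D k * cnj (e k) - cnj (D k) * e k + 2 * Q k) - S k * cnj (S k))"
        (is "?L = _") by (simp add: power2_eq_square algebra_simps)
      also have "\<dots> = (D k * cnj (e k))\<^sup>2"
        unfolding X[OF k, symmetric] Y[OF k] by simp
      finally have eq: "?L = (D k * cnj (e k))\<^sup>2" .
      show "(D k * cnj (e k))\<^sup>2 / 2 =
        (cnj (S k) * D k / 2) * (cnj (S k) * e k + D k * cnj (b k)) - W k * D k * cnj (S k)
        + 2 * of_nat p * (cnj (S k) * b k) - 2 * of_nat p * (e k * cnj (e k))
        + D k * cnj (e k) * (S k * cnj (D k) / 2 + Q k)"
        unfolding eq[symmetric] DD[OF k] by (simp add: field_simps)
    qed
  qed
  then have B': "cyc (\<lambda>k. cnj (D k) * e k / 2)" using cyc_cnj by fastforce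
  have "cyc (\<lambda>k. S k * cnj (D k) / 2 - D k * cnj (e k) / 2 - cnj (D k) * e k / 2 + Q k)"
    by (intro cyc_add cyc_diff A B B' QW)
  then show ?thesis
  proof (rule cyc_cong)
    fix k assume k: "\<not> int p dvd k"
    show "S k * cnj (S k) / 2 = S k * cnj (D k) / 2 - D k * cnj (e k) / 2 - cnj (D k) * e k / 2 + Q k"
      unfolding X[OF k] by (simp add: add_divide_distrib diff_divide_distrib)
  qed
qed

section \<open>The character sums\<close>

text \<open>The hypotheses belong to the four characters of the factor of order 4: the real ones
  give the norms of \<open>S + T\<close> and \<open>S - T\<close>, the other two give relations for
  elements congruent to \<open>S\<close> and \<open>T\<close> modulo 2.\<close>

lemma even_or_odd_part_zero:
  assumes cyc: "cyc E0" "cyc E1" "cyc E2" "cyc E3"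
    and n0: "\<And>k. \<not> int p dvd k \<Longrightarrow> (E0 k + E1 k + E2 k + E3 k) * cnj (E0 k + E1 k + E2 k + E3 k) = 4 * of_nat p"
    and n1: "\<And>k. \<not> int p dvd k \<Longrightarrow> (E0 k + \<i> * E1 k - E2 k - \<i> * E3 k) * cnj (E0 k + \<i> * E1 k - E2 k - \<i> * E3 k) = 4 * of_nat p"
    and n2: "\<And>k. \<not> int p dvd k \<Longrightarrow> (E0 k - E1 k + E2 k - E3 k) * cnj (E0 k - E1 k + E2 k - E3 k) = 4 * of_nat p"
    and n3: "\<And>k. \<not> int p dvd k \<Longrightarrow> (E0 k - \<i> * E1 k - E2 k + \<i> * E3 k) * cnj (E0 k - \<i> * E1 k - E2 k + \<i> * E3 k) = 4 * of_nat p"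
    and k: "k \<in> {1..<p}"
  shows "E0 (int k) + E2 (int k) = 0 \<or> E1 (int k) + E3 (int k) = 0"
proof -
  define S where "S k = E0 k + E2 k" for k
  define T where "T k = E1 k + E3 k" for k
  define F where "F k = E0 k + E1 k + E2 k + E3 k" for k
  define H where "H k = E0 k - E1 k + E2 k - E3 k" for k
  define X where "X k = S k * cnj (S k)" for k
  define w where "w k = S k * cnj (T k)" for k
  have cST: "cyc S" "cyc T" "cyc F" "cyc H"
    unfolding S_def T_def F_def H_def by (intro cyc_intros cyc)+
  have FH: "F k = S k + T k" "H k = S k - T k" for k
    by (simp_all add: F_def H_def S_def T_def)
  have nFH: "F k * cnj (F k) = 4 * of_nat p" "H k * cnj (H k) = 4 * of_nat p" if "\<not> int p dvd k" for k
    using n0[OF that] n2[OF that] by (simp_all only: F_def H_def)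
  \<comment> \<open>Half the sum and half the difference of the norms of \<open>S + T\<close> and
    \<open>S - T\<close>.\<close>
  have h1: "S k * cnj (S k) + T k * cnj (T k) = 4 * of_nat p"
    and h2: "S k * cnj (T k) + T k * cnj (S k) = 0" if "\<not> int p dvd k" for k
  proof -
    have *: "(S k + T k) * (cnj (S k) + cnj (T k)) = 4 * of_nat p"
      "(S k - T k) * (cnj (S k) - cnj (T k)) = 4 * of_nat p"
      using nFH[OF that] by (simp_all add: FH)
    have "2 * (S k * cnj (S k) + T k * cnj (T k)) =
        (S k + T k) * (cnj (S k) + cnj (T k)) + (S k - T k) * (cnj (S k) - cnj (T k))"
      by (simp add: algebra_simps)
    then have "2 * (S k * cnj (S k) + T k * cnj (T k)) = 2 * (4 * of_nat p)" unfolding * by simp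
    then show "S k * cnj (S k) + T k * cnj (T k) = 4 * of_nat p" by (subst (asm) mult_cancel_left) simp
    have "2 * (S k * cnj (T k) + T k * cnj (S k)) =
        (S k + T k) * (cnj (S k) + cnj (T k)) - (S k - T k) * (cnj (S k) - cnj (T k))"
      by (simp add: algebra_simps)
    then show "S k * cnj (T k) + T k * cnj (S k) = 0" unfolding * by (simp only: mult_eq_0_iff diff_self) simp
  qed
  \<comment> \<open>\<open>S - 2 * E2\<close> is \<open>E0 - E2\<close> and
    \<open>T - 2 * E3\<close> is \<open>E1 - E3\<close>, the parts seen by the characters with
    values \<open>\<i>\<close> and \<open>- \<i>\<close>.\<close>
  have UV: "(S k - 2 * E2 k) * cnj (S k - 2 * E2 k) + (T k - 2 * E3 k) * cnj (T k - 2 * E3 k) = 4 * of_nat p"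
    "(S k - 2 * E2 k) * cnj (T k - 2 * E3 k) = (T k - 2 * E3 k) * cnj (S k - 2 * E2 k)"
    if "\<not> int p dvd k" for k
  proof -
    define U V where "U = S k - 2 * E2 k" and "V = T k - 2 * E3 k"
    have "E0 k + \<i> * E1 k - E2 k - \<i> * E3 k = U + \<i> * V"
      "E0 k - \<i> * E1 k - E2 k + \<i> * E3 k = U - \<i> * V"
      by (simp_all add: U_def V_def S_def T_def algebra_simps)
    then have *: "(U + \<i> * V) * (cnj U - \<i> * cnj V) = 4 * of_nat p"
      "(U - \<i> * V) * (cnj U + \<i> * cnj V) = 4 * of_nat p"
      using n1[OF that] n3[OF that] by simp_all
    have "2 * (U * cnj U + V * cnj V) = (U + \<i> * V) * (cnj U - \<i> * cnj V) + (U - \<i> * V) * (cnj U + \<i> * cnj V)"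
      by (simp add: algebra_simps)
    then have "2 * (U * cnj U + V * cnj V) = 2 * (4 * of_nat p)" unfolding * by simp
    then show "(S k - 2 * E2 k) * cnj (S k - 2 * E2 k) + (T k - 2 * E3 k) * cnj (T k - 2 * E3 k) = 4 * of_nat p"
      unfolding U_def[symmetric] V_def[symmetric] by (subst (asm) mult_cancel_left) simp
    have "2 * \<i> * (V * cnj U - U * cnj V) = (U + \<i> * V) * (cnj U - \<i> * cnj V) - (U - \<i> * V) * (cnj U + \<i> * cnj V)"
      by (simp add: algebra_simps)
    then show "(S k - 2 * E2 k) * cnj (T k - 2 * E3 k) = (T k - 2 * E3 k) * cnj (S k - 2 * E2 k)"
      unfolding * U_def[symmetric] V_def[symmetric] by (simp only: mult_eq_0_iff diff_self) simp
  qed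
  have half: "cyc (\<lambda>k. X k / 2)"
    unfolding X_def by (rule cyc_norm_half[OF cST(1,2) cyc(3,4) h1 h2 UV])
  have FHdiv: "cyc (\<lambda>k. F k * cnj (F k) / of_nat p)" "cyc (\<lambda>k. F k * cnj (H k) / of_nat p)"
    "cyc (\<lambda>k. H k * cnj (F k) / of_nat p)" "cyc (\<lambda>k. H k * cnj (H k) / of_nat p)"
    by (rule cyc_mult_cnj_div_p[OF cST(3) nFH(1) cST(3) nFH(1)] cyc_mult_cnj_div_p[OF cST(3) nFH(1) cST(4) nFH(2)]
      cyc_mult_cnj_div_p[OF cST(4) nFH(2) cST(3) nFH(1)] cyc_mult_cnj_div_p[OF cST(4) nFH(2) cST(4) nFH(2)]; assumption)+
  \<comment> \<open>Since \<open>2 * S = F + H\<close>, the four products add up to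
    \<open>4 * X\<close>.\<close>
  have \<alpha>: "cyc (\<lambda>k. (X k / 2) / of_nat p)"
  proof (rule cyc_div_p_of_8[OF half])
    show "cyc (\<lambda>k. 8 * (X k / 2) / of_nat p)"
    proof (rule cyc_cong)
      show "cyc (\<lambda>k. F k * cnj (F k) / of_nat p + F k * cnj (H k) / of_nat p
          + H k * cnj (F k) / of_nat p + H k * cnj (H k) / of_nat p)"
        by (intro cyc_add FHdiv)
      show "8 * (X k / 2) / of_nat p = F k * cnj (F k) / of_nat p + F k * cnj (H k) / of_nat p
          + H k * cnj (F k) / of_nat p + H k * cnj (H k) / of_nat p" for k
        by (simp add: FH X_def algebra_simps flip: add_divide_distrib diff_divide_distrib)
    qed
  qed
  have v: "cyc (\<lambda>k. w k / of_nat p)"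
  proof (rule cyc_div_p_of_8)
    show "cyc w" unfolding w_def by (intro cyc_intros cST)
    show "cyc (\<lambda>k. 8 * w k / of_nat p)"
    proof (rule cyc_cong)
      show "cyc (\<lambda>k. 2 * (F k * cnj (F k) / of_nat p - F k * cnj (H k) / of_nat p
          + H k * cnj (F k) / of_nat p - H k * cnj (H k) / of_nat p))"
        by (intro cyc_intros FHdiv)
      show "8 * w k / of_nat p = 2 * (F k * cnj (F k) / of_nat p - F k * cnj (H k) / of_nat p
          + H k * cnj (F k) / of_nat p - H k * cnj (H k) / of_nat p)" for k
        by (simp add: FH w_def algebra_simps flip: add_divide_distrib diff_divide_distrib)
    qed
  qed
  \<comment> \<open>Centred and scaled so that the range from 0 to \<open>4 * p\<close> of the
    squared norm becomes the interval from -1 to 1.\<close>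
  define g where "g k = (cmod (S (int k)))\<^sup>2 / (2 * of_nat p) - 1" for k :: nat
  have X_eq: "X (int k) = of_real ((cmod (S (int k)))\<^sup>2)" for k
    by (simp only: X_def complex_norm_square)
  have norms: "(cmod (S (int k)))\<^sup>2 + (cmod (T (int k)))\<^sup>2 = 4 * of_nat p" if "k \<in> {1..<p}" for k
  proof -
    have "of_real ((cmod (S (int k)))\<^sup>2 + (cmod (T (int k)))\<^sup>2) = (of_real (4 * of_nat p) :: complex)"
      using h1[OF not_dvd_less[OF that]] by (simp only: of_real_add complex_norm_square) simp
    then show ?thesis by (simp only: of_real_eq_iff)
  qed
  have p0: "real p > 0" using p_ge_3 by simp
  have g: "g i = 0 \<or> \<bar>g i\<bar> = 1" if i: "i \<in> {1..<p}" for i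
  proof (rule cyc_bounded_imp_trivial[OF _ _ _ i])
    show "cyc (\<lambda>k. (X k / 2) / of_nat p - 1)" by (intro cyc_diff \<alpha> cyc_1)
    show "X (int k) / 2 / of_nat p - 1 = of_real (g k)" for k
      by (simp add: X_eq g_def)
    show "\<bar>g k\<bar> \<le> 1" if "k \<in> {1..<p}" for k
    proof -
      have "(cmod (S (int k)))\<^sup>2 \<le> 4 * of_nat p" using norms[OF that]
        by (smt (verit) zero_le_power2)
      then have "(cmod (S (int k)))\<^sup>2 / (2 * of_nat p) \<le> 2" using p0 by (simp add: divide_le_eq)
      moreover have "(cmod (S (int k)))\<^sup>2 / (2 * of_nat p) \<ge> 0" by simp
      ultimately show ?thesis unfolding g_def by linarith
    qed
  qed
  have w2: "(w (int i) / of_nat p)\<^sup>2 = (if g i = 0 then - 4 else 0)" if i: "i \<in> {1..<p}" for i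
  proof -
    have nS: "(cmod (S (int i)))\<^sup>2 = 2 * of_nat p * (1 + g i)" using p0 by (simp add: g_def)
    have nT: "(cmod (T (int i)))\<^sup>2 = 2 * of_nat p * (1 - g i)"
      using norms[OF i] nS by (simp add: algebra_simps)
    \<comment> \<open>\<open>w\<close> is purely imaginary, so its square is minus the product of
      the squared norms of \<open>S\<close> and \<open>T\<close>.\<close>
    have "w (int i) = - cnj (w (int i))"
      using h2[OF not_dvd_less[OF i]] by (simp add: w_def eq_neg_iff_add_eq_0 mult.commute)
    then have "(w (int i))\<^sup>2 = - (w (int i) * cnj (w (int i)))"
      by (metis mult_minus_right power2_eq_square)
    also have "w (int i) * cnj (w (int i)) = of_real ((cmod (S (int i)))\<^sup>2 * (cmod (T (int i)))\<^sup>2)"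
      by (simp only: w_def of_real_mult complex_norm_square complex_cnj_mult complex_cnj_cnj ac_simps)
    also note nS also note nT
    finally have "(w (int i))\<^sup>2 = - of_real (4 * (of_nat p)\<^sup>2 * (1 - (g i)\<^sup>2))"
      by (simp add: power2_eq_square algebra_simps)
    then have "(w (int i) / of_nat p)\<^sup>2 = - of_real (4 * (1 - (g i)\<^sup>2))"
      by (simp add: power_divide)
    then show ?thesis using g[OF i] by (auto simp: abs_if split: if_splits)
  qed
  let ?Z = "{i\<in>{1..<p}. g i = 0}"
  obtain s where s: "cyc_aug (\<lambda>k. w k / of_nat p) s" using v unfolding cyc_def by blast
  \<comment> \<open>Conjugation negates \<open>w\<close> but keeps its augmentation, which forces
    \<open>2 * s\<close> to be 0 modulo \<open>p\<close>.\<close>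
  have "cyc_aug (\<lambda>k. w k / of_nat p + cnj (w k / of_nat p)) (s + s)"
    by (intro cyc_aug_add cyc_aug_cnj s)
  moreover have "cyc_aug (\<lambda>k. w k / of_nat p + cnj (w k / of_nat p)) 0"
  proof (rule cyc_aug_cong[OF cyc_aug_of_int])
    fix k assume k: "\<not> int p dvd k"
    have "w k / of_nat p + cnj (w k / of_nat p) = (w k + cnj (w k)) / of_nat p"
      by (simp add: add_divide_distrib)
    also have "w k + cnj (w k) = 0" using h2[OF k] by (simp add: w_def mult.commute)
    finally show "w k / of_nat p + cnj (w k / of_nat p) = of_int 0" by simp
  qed
  ultimately have "int p dvd s + s - 0" by (rule cyc_aug_unique_mod)
  then have "int p dvd 2 * s" by simp
  then have ps: "int p dvd s" using not_dvd_mult not_dvd_2 by blast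
  \<comment> \<open>This trace is \<open>-4\<close> times the number of zeros of \<open>g\<close>
    and is divisible by \<open>p\<close>. There are fewer than \<open>p\<close> indices, hence no
    zeros.\<close>
  obtain t where t: "(\<Sum>k\<in>{1..<p}. (w (int k) / of_nat p)\<^sup>2) = of_int (int p * t - s\<^sup>2)"
    using trace_cyc_aug[OF cyc_aug_power[OF s, of 2]] by blast
  have "(\<Sum>k\<in>{1..<p}. (w (int k) / of_nat p)\<^sup>2) = (\<Sum>k\<in>{1..<p}. if g k = 0 then - 4 else 0)"
    using w2 by (intro sum.cong) auto
  also have "\<dots> = of_int (- 4 * int (card ?Z))"
    by (simp add: sum.inter_filter[symmetric])
  finally have "- 4 * int (card ?Z) = int p * t - s\<^sup>2"
    unfolding t of_int_eq_iff by (rule sym)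
  moreover have "int p dvd s\<^sup>2" using ps by (simp add: power2_eq_square)
  ultimately have "int p dvd - 4 * int (card ?Z)" by simp
  then have "int p dvd 4 * int (card ?Z)" by simp
  then have "p dvd card ?Z" using dvd_4_mult_cancel int_dvd_int_iff by blast
  moreover have "card ?Z \<le> card {1..<p}" by (rule card_mono) auto
  then have "card ?Z < p" using p_ge_3 by simp
  ultimately have "card ?Z = 0" using nat_dvd_not_less by blast
  then have "?Z = {}" by simp
  with g[OF k] k have "\<bar>g k\<bar> = 1" by blast
  then have "g k = -1 \<or> g k = 1" by linarith
  then show ?thesis
  proof
    assume "g k = -1"
    then have "(cmod (S (int k)))\<^sup>2 = 0" using p0 by (simp add: g_def)
    then show ?thesis by (simp add: S_def)
  next
    assume "g k = 1"
    then have "(cmod (S (int k)))\<^sup>2 = 4 * of_nat p" using p0 by (simp add: g_def field_simps)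
    then have "(cmod (T (int k)))\<^sup>2 = 0" using norms[OF k] by simp
    then show ?thesis by (simp add: T_def)
  qed
qed

section \<open>Parseval and the count of vanishing sums\<close>

text \<open>Since \<open>k\<close> is prime to \<open>p\<close>, the sums over \<open>c\<close>
  vanish off the diagonal \<open>t = t'\<close>.\<close>

lemma parseval:
  assumes k: "\<not> int p dvd k"
  shows "(\<Sum>c<p. (\<Sum>t<p. u t * \<zeta> (k * (int c * int t))) * cnj (\<Sum>t<p. u t * \<zeta> (k * (int c * int t))))
    = of_nat p * (\<Sum>t<p. u t * cnj (u t))"
proof -
  have "(\<Sum>c<p. (\<Sum>t<p. u t * \<zeta> (k * (int c * int t))) * cnj (\<Sum>t<p. u t * \<zeta> (k * (int c * int t))))
    = (\<Sum>c<p. \<Sum>t<p. \<Sum>t'<p. u t * cnj (u t') * \<zeta> (int c * (k * (int t - int t'))))"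
    by (simp add: sum_product cnj_sum algebra_simps flip: zeta_add)
  also have "\<dots> = (\<Sum>t<p. \<Sum>t'<p. u t * cnj (u t') * (\<Sum>c<p. \<zeta> (int c * (k * (int t - int t')))))"
  proof -
    have "(\<Sum>c<p. \<Sum>t<p. \<Sum>t'<p. h c t t') = (\<Sum>t<p. \<Sum>t'<p. \<Sum>c<p. h c t t')"
      for h :: "nat \<Rightarrow> nat \<Rightarrow> nat \<Rightarrow> complex"
      by (subst sum.swap) (intro sum.cong refl sum.swap)
    then show ?thesis unfolding sum_distrib_left .
  qed
  also have "\<dots> = (\<Sum>t<p. \<Sum>t'<p. if t' = t then u t * cnj (u t') * of_nat p else 0)"
  proof (intro sum.cong refl)
    fix t t' assume "t \<in> {..<p}" "t' \<in> {..<p}"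
    then have "int p dvd k * (int t - int t') \<longleftrightarrow> t' = t"
      using k prime_p by (auto simp: prime_dvd_mult_iff dest!: zdvd_imp_le mod_eq_dvd_iff[THEN iffD2])
    then show "u t * cnj (u t') * (\<Sum>c<p. \<zeta> (int c * (k * (int t - int t'))))
        = (if t' = t then u t * cnj (u t') * of_nat p else 0)"
      using sum_zeta[of "k * (int t - int t')"] by (simp add: atLeast0LessThan)
  qed
  also have "\<dots> = of_nat p * (\<Sum>t<p. u t * cnj (u t))"
    by (simp add: sum_distrib_left algebra_simps)
  finally show ?thesis .
qed

text \<open>\<open>j\<close> and \<open>c\<close> select a character and \<open>k\<close> a
  conjugate. The number of \<open>c\<close> with \<open>T = 0\<close> turns out to be 0 or
  \<open>p\<close>, so \<open>S\<close> or \<open>T\<close> vanishes for every \<open>c\<close>,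
  against Parseval.\<close>

lemma no_flat_function:
  fixes f :: "nat \<Rightarrow> nat \<Rightarrow> int"
  assumes flat: "\<And>j c k. \<not> int p dvd k \<Longrightarrow>
      (\<Sum>x<4. \<i> ^ (j * x) * (\<Sum>t<p. \<zeta> (k * (f x t + int c * int t)))) *
      cnj (\<Sum>x<4. \<i> ^ (j * x) * (\<Sum>t<p. \<zeta> (k * (f x t + int c * int t)))) = 4 * of_nat p"
  shows False
proof -
  define E where "E x c k = (\<Sum>t<p. \<zeta> (k * (f x t + int c * int t)))" for x and c :: nat and k
  have cE: "cyc (E x c)" for x c unfolding E_def by (intro cyc_sum cyc_zeta)
  have F: "(E 0 c k + \<i> ^ j * E 1 c k + \<i> ^ (j * 2) * E 2 c k + \<i> ^ (j * 3) * E 3 c k) *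
     cnj (E 0 c k + \<i> ^ j * E 1 c k + \<i> ^ (j * 2) * E 2 c k + \<i> ^ (j * 3) * E 3 c k) = 4 * of_nat p"
    if "\<not> int p dvd k" for j c k
    using flat[OF that, of j c] by (simp add: E_def eval_nat_numeral)
  have n0: "(E 0 c k + E 1 c k + E 2 c k + E 3 c k) * cnj (E 0 c k + E 1 c k + E 2 c k + E 3 c k) = 4 * of_nat p"
    and n2: "(E 0 c k - E 1 c k + E 2 c k - E 3 c k) * cnj (E 0 c k - E 1 c k + E 2 c k - E 3 c k) = 4 * of_nat p"
    and n1: "(E 0 c k + \<i> * E 1 c k - E 2 c k - \<i> * E 3 c k) * cnj (E 0 c k + \<i> * E 1 c k - E 2 c k - \<i> * E 3 c k) = 4 * of_nat p"
    and n3: "(E 0 c k - \<i> * E 1 c k - E 2 c k + \<i> * E 3 c k) * cnj (E 0 c k - \<i> * E 1 c k - E 2 c k + \<i> * E 3 c k) = 4 * of_nat p"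
    if "\<not> int p dvd k" for c k
  proof -
    have i: "\<i> ^ 2 = -1" "\<i> ^ 3 = - \<i>" "\<i> ^ 4 = 1" "\<i> ^ 6 = -1" "\<i> ^ 9 = \<i>"
      by (simp_all add: eval_nat_numeral)
    show "(E 0 c k + E 1 c k + E 2 c k + E 3 c k) * cnj (E 0 c k + E 1 c k + E 2 c k + E 3 c k) = 4 * of_nat p"
      using F[OF that, of c 0] by simp
    show "(E 0 c k - E 1 c k + E 2 c k - E 3 c k) * cnj (E 0 c k - E 1 c k + E 2 c k - E 3 c k) = 4 * of_nat p"
      using F[OF that, of c 2] by (simp add: i)
    show "(E 0 c k + \<i> * E 1 c k - E 2 c k - \<i> * E 3 c k) * cnj (E 0 c k + \<i> * E 1 c k - E 2 c k - \<i> * E 3 c k) = 4 * of_nat p"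
      using F[OF that, of c 1] by (simp add: i)
    show "(E 0 c k - \<i> * E 1 c k - E 2 c k + \<i> * E 3 c k) * cnj (E 0 c k - \<i> * E 1 c k - E 2 c k + \<i> * E 3 c k) = 4 * of_nat p"
      using F[OF that, of c 3] by (simp add: i)
  qed
  define S where "S c k = E 0 c k + E 2 c k" for c k
  define T where "T c k = E 1 c k + E 3 c k" for c k
  have zero: "S c (int k) = 0 \<or> T c (int k) = 0" if "k \<in> {1..<p}" for c k
    unfolding S_def T_def
    by (rule even_or_odd_part_zero[OF cE cE cE cE n0 n1 n2 n3 that])
  have norm: "S c k * cnj (S c k) = 4 * of_nat p" if "T c k = 0" "\<not> int p dvd k" for c k
  proof -
    have "E 0 c k + E 1 c k + E 2 c k + E 3 c k = S c k + T c k" by (simp add: S_def T_def)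
    then show ?thesis using n0[OF that(2), of c] that(1) by simp
  qed
  define n where "n k = card {c\<in>{..<p}. T c (int k) = 0}" for k :: nat
  define u where "u x y k t = \<zeta> (k * f x t) + \<zeta> (k * f y t)" for x y k t
  have Eu: "E x c k + E y c k = (\<Sum>t<p. u x y k t * \<zeta> (k * (int c * int t)))" for x y c k
    by (simp add: E_def u_def algebra_simps sum.distrib flip: zeta_add)
  have pars: "(\<Sum>c<p. (E x c k + E y c k) * cnj (E x c k + E y c k)) = of_nat p * (\<Sum>t<p. u x y k t * cnj (u x y k t))"
    if "\<not> int p dvd k" for x y k
    unfolding Eu by (rule parseval[OF that])
  \<comment> \<open>If all sums vanished, so would every \<open>u x y k t\<close>, which is a sum of
    two \<open>p\<close>-th roots of unity.\<close>
  have nonzero: "\<exists>c<p. E x c k + E y c k \<noteq> 0" if "\<not> int p dvd k" for x y k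
  proof (rule ccontr)
    assume "\<not> ?thesis"
    then have "of_nat p * (\<Sum>t<p. u x y k t * cnj (u x y k t)) = 0"
      using pars[OF that, of x y] by simp
    then have "(\<Sum>t<p. of_real ((cmod (u x y k t))\<^sup>2)) = (0 :: complex)"
      by (simp only: complex_norm_square) simp
    then have "(\<Sum>t<p. (cmod (u x y k t))\<^sup>2) = 0"
      by (metis of_real_eq_0_iff of_real_sum)
    then have "\<forall>t<p. u x y k t = 0"
      by (subst (asm) sum_nonneg_eq_0_iff) auto
    then show False using p_ge_3 zeta_add_neq_0 unfolding u_def
      by (metis neq0_conv p_neq_0)
  qed
  \<comment> \<open>The squared norm of \<open>S\<close> is \<open>4 * p\<close> at the
    \<open>n k\<close> places where \<open>T\<close> is 0; elsewhere \<open>S\<close> itself is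
    0.\<close>
  have val: "(\<Sum>t<p. u 0 2 (int k) t * cnj (u 0 2 (int k) t)) = of_nat (4 * n k)" if k: "k \<in> {1..<p}" for k
  proof -
    note nd = not_dvd_less[OF k]
    have "of_nat p * (\<Sum>t<p. u 0 2 (int k) t * cnj (u 0 2 (int k) t))
       = (\<Sum>c<p. S c (int k) * cnj (S c (int k)))"
      using pars[OF nd, of 0 2] by (simp add: S_def)
    also have "\<dots> = (\<Sum>c<p. if T c (int k) = 0 then 4 * of_nat p else 0)"
      using zero[OF k] norm nd by (intro sum.cong) auto
    also have "\<dots> = of_nat p * of_nat (4 * n k)"
      by (simp add: n_def sum.inter_filter[symmetric])
    finally show ?thesis by (subst (asm) mult_cancel_left) simp
  qed
  \<comment> \<open>Each \<open>u\<close> has augmentation \<open>1 + 1\<close>, so the total is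
    \<open>4 * p\<close>, a multiple of \<open>p\<close>.\<close>
  have "cyc_aug (\<lambda>k. \<Sum>t<p. u 0 2 k t * cnj (u 0 2 k t)) (\<Sum>t<p. (1 + 1) * (1 + 1))"
    unfolding u_def by (intro cyc_aug_sum cyc_aug_mult cyc_aug_cnj cyc_aug_add cyc_aug_zeta)
  moreover have "int p dvd (\<Sum>t<p. (1 + 1) * (1 + 1))" by simp
  moreover have one: "1 \<in> {1..<p}" using p_ge_3 by auto
  ultimately have "p dvd 4 * n 1"
    using val dvd_nat_values_of_dvd_aug[where v = "\<lambda>k. 4 * n k"] by blast
  then have "int p dvd 4 * int (n 1)" by (metis int_dvd_int_iff of_nat_mult of_nat_numeral)
  then have pn: "p dvd n 1" using dvd_4_mult_cancel int_dvd_int_iff by blast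
  have le: "n 1 \<le> card {..<p}" unfolding n_def by (rule card_mono) auto
  have nd: "\<not> int p dvd 1" using p_ge_3 by simp
  consider "n 1 = 0" | "n 1 = p" using dvd_imp_le[OF pn] le by (cases "n 1 = 0") auto
  then show False
  proof cases
    case 1
    then have "\<forall>c<p. T c 1 \<noteq> 0" by (auto simp: n_def)
    then have "\<forall>c<p. S c 1 = 0" using zero[of 1] one by auto
    then show False using nonzero[OF nd, of 0 2] by (auto simp: S_def)
  next
    case 2
    then have "{c\<in>{..<p}. T c (int 1) = 0} = {..<p}"
      by (intro card_subset_eq) (auto simp: n_def)
    then have "\<forall>c<p. T c 1 = 0" by auto
    then show False using nonzero[OF nd, of 1 3] by (auto simp: T_def)
  qed
qed

end

section \<open>Relative difference sets\<close>

text \<open>Translation by \<open>n\<close> permutes \<open>N\<close> and multiplies the sum by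
  \<open>\<chi> n\<close>.\<close>

lemma character_sum_subgroup_eq_0:
  fixes \<chi> :: "'a \<Rightarrow> complex"
  assumes "group G" "subgroup N G" "finite N"
    and mult: "\<And>x y. x \<in> carrier G \<Longrightarrow> y \<in> carrier G \<Longrightarrow> \<chi> (x \<otimes>\<^bsub>G\<^esub> y) = \<chi> x * \<chi> y"
    and n: "n \<in> N" "\<chi> n \<noteq> 1"
  shows "(\<Sum>x\<in>N. \<chi> x) = 0"
proof -
  interpret group G by fact
  interpret N: subgroup N G by fact
  have sub: "x \<in> N \<Longrightarrow> x \<in> carrier G" for x using N.subset by blast
  have "inj_on (\<lambda>x. n \<otimes>\<^bsub>G\<^esub> x) N" using n sub by (intro inj_onI) auto
  moreover have "(\<lambda>x. n \<otimes>\<^bsub>G\<^esub> x) ` N \<subseteq> N" using n by auto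
  ultimately have "bij_betw (\<lambda>x. n \<otimes>\<^bsub>G\<^esub> x) N N"
    using endo_inj_surj[OF assms(3)] by (simp add: bij_betw_def)
  then have "(\<Sum>x\<in>N. \<chi> x) = (\<Sum>x\<in>N. \<chi> (n \<otimes>\<^bsub>G\<^esub> x))"
    by (rule sum.reindex_bij_betw[symmetric])
  also have "\<dots> = \<chi> n * (\<Sum>x\<in>N. \<chi> x)"
    using mult n sub by (simp add: sum_distrib_left)
  finally have "(1 - \<chi> n) * (\<Sum>x\<in>N. \<chi> x) = 0" by (simp add: algebra_simps)
  with n show ?thesis by simp
qed

text \<open>The product sums \<open>\<chi>\<close> over all quotients of elements of
  \<open>R\<close>: the identity occurs \<open>k\<close> times, other elements of \<open>N\<close>
  never, elements outside \<open>N\<close> \<open>l\<close> times. As \<open>\<chi>\<close> sums to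
  0 over both \<open>G\<close> and \<open>N\<close>, only the identity contributes.\<close>

lemma relative_difference_set_character_norm:
  fixes \<chi> :: "'a \<Rightarrow> complex" and G :: "('a, 'b) monoid_scheme"
  assumes rds: "relative_difference_set G N m n k l R"
    and mult: "\<And>x y. x \<in> carrier G \<Longrightarrow> y \<in> carrier G \<Longrightarrow> \<chi> (x \<otimes>\<^bsub>G\<^esub> y) = \<chi> x * \<chi> y"
    and unit: "\<And>x. x \<in> carrier G \<Longrightarrow> cmod (\<chi> x) = 1"
    and nontriv: "h \<in> N" "\<chi> h \<noteq> 1"
  shows "(\<Sum>r\<in>R. \<chi> r) * cnj (\<Sum>r\<in>R. \<chi> r) = of_nat k"
proof -
  note rds = rds[unfolded relative_difference_set_def]
  interpret group G using rds by blast
  have fin: "finite (carrier G)" and N: "subgroup N G" and R: "R \<subseteq> carrier G" "card R = k"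
    using rds by auto
  have NG: "N \<subseteq> carrier G" using N by (rule subgroup.subset)
  have oneN: "\<one>\<^bsub>G\<^esub> \<in> N" using N by (rule subgroup.one_closed)
  have finR: "finite R" and finN: "finite N" using fin R NG finite_subset by auto
  have one: "\<chi> \<one>\<^bsub>G\<^esub> = 1"
  proof -
    have "\<chi> \<one>\<^bsub>G\<^esub> * \<chi> \<one>\<^bsub>G\<^esub> = \<chi> \<one>\<^bsub>G\<^esub>" using mult[of "\<one>\<^bsub>G\<^esub>" "\<one>\<^bsub>G\<^esub>"] by simp
    moreover have "\<chi> \<one>\<^bsub>G\<^esub> \<noteq> 0" using unit[of "\<one>\<^bsub>G\<^esub>"] by auto
    ultimately show ?thesis by simp
  qed
  have inv: "\<chi> (inv\<^bsub>G\<^esub> x) = cnj (\<chi> x)" if x: "x \<in> carrier G" for x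
  proof -
    have "\<chi> x * \<chi> (inv\<^bsub>G\<^esub> x) = 1" using mult[of x "inv\<^bsub>G\<^esub> x"] x one by simp
    moreover have "\<chi> x * cnj (\<chi> x) = 1" using unit[OF x] by (simp add: complex_norm_square[symmetric])
    moreover have "\<chi> x \<noteq> 0" using unit[OF x] by auto
    ultimately show ?thesis by (metis mult_left_cancel)
  qed
  let ?d = "\<lambda>(r1, r2). r1 \<otimes>\<^bsub>G\<^esub> inv\<^bsub>G\<^esub> r2"
  define c where "c g = card {(r1, r2). r1 \<in> R \<and> r2 \<in> R \<and> g = r1 \<otimes>\<^bsub>G\<^esub> inv\<^bsub>G\<^esub> r2}" for g
  have c1: "c g = l" if "g \<in> carrier G - N" for g using rds that unfolding c_def by blast
  have c2: "c g = 0" if "g \<in> N - {\<one>\<^bsub>G\<^esub>}" for g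
  proof -
    have "{(r1, r2). r1 \<in> R \<and> r2 \<in> R \<and> g = r1 \<otimes>\<^bsub>G\<^esub> inv\<^bsub>G\<^esub> r2} = {}" using rds that by auto
    then show ?thesis unfolding c_def by (simp only: card.empty)
  qed
  have c3: "c \<one>\<^bsub>G\<^esub> = k"
  proof -
    have "r1 = r2" if "r1 \<in> R" "r2 \<in> R" "\<one>\<^bsub>G\<^esub> = r1 \<otimes>\<^bsub>G\<^esub> inv\<^bsub>G\<^esub> r2" for r1 r2
    proof -
      have "r1 \<in> carrier G" "r2 \<in> carrier G" using that R by auto
      then show ?thesis using that(3) by (metis inv_closed inv_equality inv_inv)
    qed
    then have "{(r1, r2). r1 \<in> R \<and> r2 \<in> R \<and> \<one>\<^bsub>G\<^esub> = r1 \<otimes>\<^bsub>G\<^esub> inv\<^bsub>G\<^esub> r2} = (\<lambda>r. (r, r)) ` R"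
      using R by auto
    then show ?thesis unfolding c_def using R by (simp add: card_image inj_on_def)
  qed
  have "(\<Sum>r\<in>R. \<chi> r) * cnj (\<Sum>r\<in>R. \<chi> r) = (\<Sum>(r1, r2)\<in>R \<times> R. \<chi> r1 * cnj (\<chi> r2))"
    by (simp add: sum_product sum.cartesian_product cnj_sum)
  also have "\<dots> = (\<Sum>x\<in>R \<times> R. \<chi> (?d x))"
    using R mult inv by (intro sum.cong) (auto simp: subset_iff)
  also have "\<dots> = (\<Sum>g\<in>carrier G. \<Sum>x\<in>{x \<in> R \<times> R. ?d x = g}. \<chi> (?d x))"
    using R fin finR by (intro sum.group[symmetric]) auto
  also have "\<dots> = (\<Sum>g\<in>carrier G. of_nat (c g) * \<chi> g)"
  proof (rule sum.cong[OF refl])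
    fix g
    have "(\<Sum>x\<in>{x \<in> R \<times> R. ?d x = g}. \<chi> (?d x)) = (\<Sum>x\<in>{x \<in> R \<times> R. ?d x = g}. \<chi> g)"
      by (rule sum.cong) auto
    moreover have "{x \<in> R \<times> R. ?d x = g} = {(r1, r2). r1 \<in> R \<and> r2 \<in> R \<and> g = r1 \<otimes>\<^bsub>G\<^esub> inv\<^bsub>G\<^esub> r2}"
      by auto
    ultimately show "(\<Sum>x\<in>{x \<in> R \<times> R. ?d x = g}. \<chi> (?d x)) = of_nat (c g) * \<chi> g"
      by (simp add: c_def)
  qed
  also have "\<dots> = (\<Sum>g\<in>carrier G - N. of_nat (c g) * \<chi> g) + (\<Sum>g\<in>N. of_nat (c g) * \<chi> g)"
    using NG fin by (rule sum.subset_diff)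
  also have "(\<Sum>g\<in>carrier G - N. of_nat (c g) * \<chi> g) = of_nat l * ((\<Sum>g\<in>carrier G. \<chi> g) - (\<Sum>g\<in>N. \<chi> g))"
    using c1 by (simp add: right_diff_distrib sum_distrib_left sum_diff[OF fin NG])
  also have "(\<Sum>g\<in>carrier G. \<chi> g) = 0"
    using character_sum_subgroup_eq_0[OF _ subgroup_self fin mult _ nontriv(2)] nontriv(1) NG is_group by blast
  also have "(\<Sum>g\<in>N. \<chi> g) = 0"
    using character_sum_subgroup_eq_0[OF _ N finN mult nontriv] is_group by blast
  also have "(\<Sum>g\<in>N. of_nat (c g) * \<chi> g) = (\<Sum>g\<in>{\<one>\<^bsub>G\<^esub>}. of_nat (c g) * \<chi> g)"
    using oneN finN c2 by (intro sum.mono_neutral_right) auto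
  finally show ?thesis using one c3 by simp
qed

lemma imaginary_unit_power_mod_4: "\<i> ^ (j * (m mod 4)) = \<i> ^ (j * m)"
proof -
  have "(\<i> ^ j) ^ 4 = (\<i> ^ 4) ^ j" by (simp only: power_mult[symmetric] mult.commute)
  also have "\<i> ^ 4 = 1" by (simp add: eval_nat_numeral)
  finally have "(\<i> ^ j) ^ 4 = 1" by simp
  then have "(\<i> ^ j) ^ (4 * (m div 4) + m mod 4) = (\<i> ^ j) ^ (m mod 4)"
    by (simp only: power_add power_mult power_one mult_1)
  then show ?thesis by (simp add: power_mult)
qed

section \<open>Coordinates adapted to \<open>N\<close> and the contradiction\<close>

theorem theorem4p2:
  fixes p :: nat
  assumes "prime p" and "odd p"
  defines "G \<equiv> integer_mod_group 4 \<times>\<times> (integer_mod_group p \<times>\<times> integer_mod_group p)"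
  shows "\<not> (\<exists>N R. subgroup N G \<and> card N = p \<and>
               relative_difference_set G N (4 * p) p (4 * p) 4 R)"
proof
  assume "\<exists>N R. subgroup N G \<and> card N = p \<and> relative_difference_set G N (4 * p) p (4 * p) 4 R"
  then obtain N R where N: "subgroup N G" "card N = p"
    and rds: "relative_difference_set G N (4 * p) p (4 * p) 4 R" by blast
  interpret odd_prime p by unfold_locales fact+
  have p0: "int p > 0" using p_ge_3 by simp
  have carrier: "carrier G = {0..<4} \<times> {0..<int p} \<times> {0..<int p}"
    by (simp add: G_def carrier_integer_mod_group)
  have mult: "(x, y, z) \<otimes>\<^bsub>G\<^esub> (x', y', z') = ((x + x') mod 4, (y + y') mod int p, (z + z') mod int p)"
    for x y z x' y' z' by (simp add: G_def)
  have one: "\<one>\<^bsub>G\<^esub> = (0, 0, 0)" by (simp add: G_def)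
  have grp: "group G" by (simp add: G_def DirProd_group)
  have inv: "inv\<^bsub>G\<^esub> (x, y, z) = ((- x) mod 4, (- y) mod int p, (- z) mod int p)"
    if "(x, y, z) \<in> carrier G" for x y z
    using that by (simp add: G_def DirProd_group)
  interpret G: group G by (rule grp)
  interpret H: group "G\<lparr>carrier := N\<rparr>" using N(1) grp by (rule subgroup.subgroup_is_group)
  have NG: "N \<subseteq> carrier G" using N(1) by (rule subgroup.subset)
  have R: "R \<subseteq> carrier G" "card R = 4 * p"
    and noN: "\<And>g r1 r2. g \<in> N \<Longrightarrow> g \<noteq> \<one>\<^bsub>G\<^esub> \<Longrightarrow> r1 \<in> R \<Longrightarrow> r2 \<in> R \<Longrightarrow> g \<noteq> r1 \<otimes>\<^bsub>G\<^esub> inv\<^bsub>G\<^esub> r2"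
    using rds unfolding relative_difference_set_def by auto
  have "\<not> N \<subseteq> {\<one>\<^bsub>G\<^esub>}" using N(2) p_ge_3 card_mono[of "{\<one>\<^bsub>G\<^esub>}" N] by auto
  then obtain n0 n1 n2 where n: "(n0, n1, n2) \<in> N" "(n0, n1, n2) \<noteq> (0, 0, 0)"
    unfolding one by auto
  have pow: "(n0, n1, n2) [^]\<^bsub>G\<lparr>carrier := N\<rparr>\<^esub> (m::nat)
      = ((int m * n0) mod 4, (int m * n1) mod int p, (int m * n2) mod int p)" for m
  proof (induction m)
    case (Suc m)
    then show ?case by (simp add: mult mod_simps algebra_simps)
  qed (simp add: one)
  have multN: "((int m * n0) mod 4, (int m * n1) mod int p, (int m * n2) mod int p) \<in> N" for m
    using H.nat_pow_closed[of "(n0, n1, n2)" m] n(1) unfolding pow by simp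
  have nc: "0 \<le> n0" "n0 < 4" "0 \<le> n1" "n1 < int p" "0 \<le> n2" "n2 < int p"
    using n(1) NG unfolding carrier by auto
  \<comment> \<open>\<open>N\<close> has odd order \<open>p\<close>, which makes the component of
    order dividing 4 trivial.\<close>
  have "(n0, n1, n2) [^]\<^bsub>G\<lparr>carrier := N\<rparr>\<^esub> p = \<one>\<^bsub>G\<^esub>"
    using H.pow_order_eq_1[of "(n0, n1, n2)"] n(1) N(2) by (simp add: Coset.order_def)
  then have "int p * n0 mod 4 = 0" unfolding pow one by simp
  then have "4 dvd int p * n0" by (simp add: dvd_eq_mod_eq_0)
  moreover have "coprime 4 (int p)"
  proof -
    have "coprime (2 ^ 2) (int p)" using assms(2) by (simp only: coprime_power_left_iff) simp
    then show ?thesis by simp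
  qed
  ultimately have "4 dvd n0" by (simp add: coprime_dvd_mult_right_iff)
  then have n0: "n0 = 0" using nc(1,2) by (auto dest: zdvd_imp_le)
  have cop: "coprime a (int p)" if "\<not> int p dvd a" for a
    using prime_imp_coprime[of "int p" a] that assms(1) by (simp add: coprime_commute)
  \<comment> \<open>\<open>u * y + v * z\<close> serves as coordinate along \<open>N\<close>, with
    value 1 modulo \<open>p\<close> at the generator.\<close>
  obtain u v where uv: "[u * n1 + v * n2 = 1] (mod int p)"
  proof (cases "n1 = 0")
    case False
    then have "\<not> int p dvd n1" using nc by (auto dest: zdvd_imp_le)
    then have "coprime n1 (int p)" by (rule cop)
    then obtain u where "[n1 * u = 1] (mod int p)" using cong_solve_coprime_int by blast
    then show ?thesis using that[of u 0] by (simp add: mult.commute)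
  next
    case True
    then have "n2 \<noteq> 0" using n(2) n0 by simp
    then have "\<not> int p dvd n2" using nc by (auto dest: zdvd_imp_le)
    then have "coprime n2 (int p)" by (rule cop)
    then obtain v where "[n2 * v = 1] (mod int p)" using cong_solve_coprime_int by blast
    then show ?thesis using that[of 0 v] by (simp add: mult.commute)
  qed
  \<comment> \<open>The required multiple of the generator is given by the coordinate
    \<open>u * a + v * b\<close>.\<close>
  have inN: "(0, a mod int p, b mod int p) \<in> N" if ab: "[n2 * a = n1 * b] (mod int p)" for a b
  proof -
    define m where "m = nat ((u * a + v * b) mod int p)"
    have m: "[int m = u * a + v * b] (mod int p)" by (simp add: m_def cong_def)
    have "[int m * n1 = (u * a + v * b) * n1] (mod int p)" using m by (rule cong_scalar_right)
    also have "(u * a + v * b) * n1 = u * n1 * a + v * (n1 * b)" by (simp add: algebra_simps)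
    also have "[\<dots> = u * n1 * a + v * (n2 * a)] (mod int p)"
      using ab by (intro cong_add cong_scalar_left cong_refl) (rule cong_sym)
    also have "u * n1 * a + v * (n2 * a) = (u * n1 + v * n2) * a" by (simp add: algebra_simps)
    also have "[\<dots> = 1 * a] (mod int p)" using uv by (rule cong_scalar_right)
    finally have 1: "int m * n1 mod int p = a mod int p" by (simp add: cong_def)
    have "[int m * n2 = (u * a + v * b) * n2] (mod int p)" using m by (rule cong_scalar_right)
    also have "(u * a + v * b) * n2 = u * (n2 * a) + v * n2 * b" by (simp add: algebra_simps)
    also have "[\<dots> = u * (n1 * b) + v * n2 * b] (mod int p)"
      using ab by (intro cong_add cong_scalar_left cong_refl)
    also have "u * (n1 * b) + v * n2 * b = (u * n1 + v * n2) * b" by (simp add: algebra_simps)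
    also have "[\<dots> = 1 * b] (mod int p)" using uv by (rule cong_scalar_right)
    finally have 2: "int m * n2 mod int p = b mod int p" by (simp add: cong_def)
    show ?thesis using multN[of m] 1 2 n0 by simp
  qed
  \<comment> \<open>Labels of the cosets of \<open>N\<close>: the form
    \<open>n2 * y - n1 * z\<close> vanishes along \<open>N\<close>.\<close>
  define \<phi> :: "int \<times> int \<times> int \<Rightarrow> nat \<times> nat" where
    "\<phi> = (\<lambda>(x, y, z). (nat x, nat ((n2 * y - n1 * z) mod int p)))"
  \<comment> \<open>Elements of \<open>R\<close> with equal labels differ by an element of
    \<open>N\<close>, which can only be the identity.\<close>
  have "inj_on \<phi> R"
  proof (rule inj_onI)
    fix r r' assume r: "r \<in> R" "r' \<in> R" "\<phi> r = \<phi> r'"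
    obtain x y z x' y' z' where xyz: "r = (x, y, z)" "r' = (x', y', z')" by (metis prod_cases3)
    have car: "(x, y, z) \<in> carrier G" "(x', y', z') \<in> carrier G" using r R xyz by auto
    then have b: "0 \<le> x" "x < 4" "0 \<le> x'" "x' < 4" "0 \<le> y" "y < int p" "0 \<le> y'" "y' < int p"
      "0 \<le> z" "z < int p" "0 \<le> z'" "z' < int p" by (auto simp: carrier)
    have xx: "x = x'" and "(n2 * y - n1 * z) mod int p = (n2 * y' - n1 * z') mod int p"
      using r(3) b by (auto simp: xyz \<phi>_def eq_nat_nat_iff)
    then have "int p dvd (n2 * y - n1 * z) - (n2 * y' - n1 * z')" by (simp add: mod_eq_dvd_iff)
    then have "int p dvd n2 * (y - y') - n1 * (z - z')" by (simp add: algebra_simps)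
    then have "[n2 * (y - y') = n1 * (z - z')] (mod int p)" by (simp add: cong_iff_dvd_diff)
    from inN[OF this] have "(0, (y - y') mod int p, (z - z') mod int p) \<in> N" .
    moreover have d: "r \<otimes>\<^bsub>G\<^esub> inv\<^bsub>G\<^esub> r' = (0, (y - y') mod int p, (z - z') mod int p)"
      unfolding xyz inv[OF car(2)] mult using xx by (simp add: mod_simps)
    ultimately have "r \<otimes>\<^bsub>G\<^esub> inv\<^bsub>G\<^esub> r' = \<one>\<^bsub>G\<^esub>" using noN[OF _ _ r(1,2)] by metis
    then have "int p dvd y - y'" "int p dvd z - z'" unfolding d one by (auto simp: dvd_eq_mod_eq_0)
    then have "y mod int p = y' mod int p" "z mod int p = z' mod int p" by (simp_all add: mod_eq_dvd_iff)
    then show "r = r'" using b xx xyz by simp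
  qed
  moreover have "\<phi> ` R = {..<4} \<times> {..<p}"
  proof (rule card_subset_eq)
    show "\<phi> ` R \<subseteq> {..<4} \<times> {..<p}"
      using R(1) p0 by (auto simp: \<phi>_def carrier nat_less_iff dest!: subsetD)
    show "card (\<phi> ` R) = card ({..<4} \<times> {..<p} :: (nat \<times> nat) set)"
      using card_image[OF \<open>inj_on \<phi> R\<close>] R(2) by (simp add: card_cartesian_product)
  qed simp
  ultimately have bij: "bij_betw \<phi> R ({..<4} \<times> {..<p})" by (simp add: bij_betw_def)
  define \<psi> where "\<psi> = inv_into R \<phi>"
  have bij': "bij_betw \<psi> ({..<4} \<times> {..<p}) R" unfolding \<psi>_def using bij by (rule bij_betw_inv_into)
  \<comment> \<open>The position along \<open>N\<close> of the unique element of \<open>R\<close> in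
    the coset labelled \<open>(x, t)\<close>.\<close>
  define f where "f x t = (case \<psi> (x, t) of (_, y, z) \<Rightarrow> u * y + v * z)" for x t
  show False
  proof (rule no_flat_function)
    fix j c :: nat and k :: int
    assume k: "\<not> int p dvd k"
    \<comment> \<open>In the new coordinates the exponent is \<open>k\<close> along \<open>N\<close>
      and \<open>k * c\<close> across its cosets.\<close>
    define \<chi> where "\<chi> = (\<lambda>(x, y, z). \<i> ^ (j * nat x) * \<zeta> (k * (u * y + v * z + int c * (n2 * y - n1 * z))))"
    have "(\<Sum>r\<in>R. \<chi> r) * cnj (\<Sum>r\<in>R. \<chi> r) = of_nat (4 * p)"
    proof (rule relative_difference_set_character_norm[OF rds])
      fix g h assume "g \<in> carrier G" "h \<in> carrier G"
      then obtain x y z x' y' z' where g: "g = (x, y, z)" "h = (x', y', z')"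
        and b: "0 \<le> x" "0 \<le> x'" unfolding carrier by auto
      have "nat ((x + x') mod 4) = (nat x + nat x') mod 4"
        using b by (simp add: nat_mod_distrib nat_add_distrib)
      then have 1: "\<i> ^ (j * nat ((x + x') mod 4)) = \<i> ^ (j * nat x) * \<i> ^ (j * nat x')"
        by (simp add: imaginary_unit_power_mod_4 distrib_left power_add)
      let ?Y = "(y + y') mod int p" and ?Z = "(z + z') mod int p"
      have "[k * (u * ?Y + v * ?Z + int c * (n2 * ?Y - n1 * ?Z))
          = k * (u * (y + y') + v * (z + z') + int c * (n2 * (y + y') - n1 * (z + z')))] (mod int p)"
        by (intro cong_scalar_left cong_add cong_diff) (simp_all add: cong_def)
      then have 2: "\<zeta> (k * (u * ?Y + v * ?Z + int c * (n2 * ?Y - n1 * ?Z)))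
          = \<zeta> (k * (u * y + v * z + int c * (n2 * y - n1 * z)))
            * \<zeta> (k * (u * y' + v * z' + int c * (n2 * y' - n1 * z')))"
        unfolding zeta_add[symmetric] by (subst zeta_cong) (auto simp: algebra_simps)
      show "\<chi> (g \<otimes>\<^bsub>G\<^esub> h) = \<chi> g * \<chi> h"
        unfolding g mult \<chi>_def prod.case 1 2 by (simp add: ac_simps)
    next
      fix g assume "g \<in> carrier G"
      then show "cmod (\<chi> g) = 1"
        by (auto simp: \<chi>_def norm_mult norm_power \<zeta>_def split: prod.split)
    next
      show "(n0, n1, n2) \<in> N" by (rule n(1))
      \<comment> \<open>At the generator the part with \<open>c\<close> cancels and the exponent is
        \<open>k\<close> modulo \<open>p\<close>, so \<open>\<chi>\<close> is nontrivial on
        \<open>N\<close>.\<close>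
      have "\<not> int p dvd k * (u * n1 + v * n2)"
      proof
        assume "int p dvd k * (u * n1 + v * n2)"
        moreover have "[k * (u * n1 + v * n2) = k * 1] (mod int p)" using uv by (rule cong_scalar_left)
        ultimately show False using k cong_dvd_iff by fastforce
      qed
      then show "\<chi> (n0, n1, n2) \<noteq> 1" by (simp add: \<chi>_def n0 zeta_eq_1_iff algebra_simps)
    qed
    moreover have "(\<Sum>r\<in>R. \<chi> r) = (\<Sum>x<4. \<i> ^ (j * x) * (\<Sum>t<p. \<zeta> (k * (f x t + int c * int t))))"
    proof -
      have "(\<Sum>r\<in>R. \<chi> r) = (\<Sum>xt\<in>{..<4} \<times> {..<p}. \<chi> (\<psi> xt))"
        using bij' by (rule sum.reindex_bij_betw[symmetric])
      also have "\<dots> = (\<Sum>(x, t)\<in>{..<4} \<times> {..<p}. \<i> ^ (j * x) * \<zeta> (k * (f x t + int c * int t)))"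
      proof (rule sum.cong[OF refl])
        fix xt :: "nat \<times> nat" assume "xt \<in> {..<4} \<times> {..<p}"
        then obtain x t where xt_eq: "xt = (x, t)" and xt: "x \<in> {..<4}" "t \<in> {..<p}" by blast
        obtain x' y z where r: "\<psi> (x, t) = (x', y, z)" by (metis prod_cases3)
        have "\<phi> (\<psi> (x, t)) = (x, t)"
          unfolding \<psi>_def using bij xt by (intro bij_betw_inv_into_right) auto
        then have x: "nat x' = x" and t: "(n2 * y - n1 * z) mod int p = int t"
          unfolding r \<phi>_def using p0 by auto
        have "[n2 * y - n1 * z = int t] (mod int p)" using t by (metis cong_def mod_mod_trivial)
        then have "[k * (u * y + v * z + int c * (n2 * y - n1 * z)) = k * (f x t + int c * int t)] (mod int p)"
          unfolding f_def r by (auto intro!: cong_scalar_left cong_add)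
        then have "\<chi> (\<psi> (x, t)) = \<i> ^ (j * x) * \<zeta> (k * (f x t + int c * int t))"
          unfolding r \<chi>_def using x by (simp add: zeta_cong)
        then show "\<chi> (\<psi> xt) = (case xt of (x, t) \<Rightarrow> \<i> ^ (j * x) * \<zeta> (k * (f x t + int c * int t)))"
          by (simp add: xt_eq)
      qed
      also have "\<dots> = (\<Sum>x<4. \<i> ^ (j * x) * (\<Sum>t<p. \<zeta> (k * (f x t + int c * int t))))"
        by (simp add: sum.cartesian_product[symmetric] sum_distrib_left)
      finally show ?thesis .
    qed
    ultimately show "(\<Sum>x<4. \<i> ^ (j * x) * (\<Sum>t<p. \<zeta> (k * (f x t + int c * int t)))) *
      cnj (\<Sum>x<4. \<i> ^ (j * x) * (\<Sum>t<p. \<zeta> (k * (f x t + int c * int t)))) = 4 * of_nat p"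
      by simp
  qed
qed

end
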